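(* Let $a(s)=a_2s^2+a_1s+a_0$ and $b(s)=b_2s^2+b_1s+b_0$ be coprime real polynomials, with $a_2,b_2$ not both zero and $b_i>0$ for at least one $i\in\{0,1,2\}$, and let $Z=a/b$. Let the polynomials $\alpha,\beta,f_0,f_1,c_0,c_1,c_2\in\mathbb{R}[u]$ and $d_0,d_1,d_2,\eta,\gamma_1,\gamma_2,\gamma_3,\lambda_1\in\mathbb{R}[u,v]$, the number $F_0=F_0(a,b)$, the conditions (Q9), (F5) on real numbers $\tilde x,\tilde z$, and the network classes be as defined in the context. If $Z$ is the impedance of a network from $\mathcal{N}_{14}$, then either $Z\in\mathcal{Z}_{1,1}$, or $Z\in\mathcal{Z}_{0,2}$, or there exist $\tilde x\ge0$ and $\tilde z\ne0$ such that conditions (Q9) and (F5) hold. In this last case, an explicit realization for $Z$ is obtained as follows. If $\tilde x\ge0$ and $\tilde z\ne0$ are such that (Q9) holds, then $\beta(\tilde x),d_0(\tilde x,\tilde z),\lambda_1(\tilde x,\tilde z)\ne0$, $\gamma_1(\tilde x,\tilde z)>0$, and $Z$ is the impedance of $N_{14}$ when (all polynomials evaluated at $(u,v)=(\tilde x,\tilde z)$) $$R_1=\tfrac{c_0}{d_0},\quad R_2=\tfrac{\gamma_1^2}{d_0\lambda_1},\quad G_3=\tfrac{d_2\lambda_1}{\beta^3\eta F_0},\quad R_4=\tfrac\alpha\beta,\quad R_5=\tfrac{\tilde x}{\beta\tilde z},\quad C_1=\beta\tilde z,\quad L_1=\tfrac{\beta^3\eta\gamma_1F_0}{\lambda_1^2},\quad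 L_2=\tfrac{\gamma_1}{d_0^2}.$$ In particular, if (F5) holds, then $G_3=0$, so this network is from class $\mathcal{N}_{29}$.
   Context: **Networks.** One-port networks are built from resistors (impedance $R$), inductors (impedance $Ls$, $L>0$) and capacitors (impedance $1/(Cs)$, $C>0$). A single element is series-parallel, and a series connection (impedances add, written $+$) or parallel connection ($1/(Z_1\parallel Z_2)=1/Z_1+1/Z_2$) of two series-parallel networks is series-parallel. A resistor of resistance $R=0$ is a short circuit; a resistor of conductance $G=0$, written $1/G$, is an open circuit. $\mathcal{Z}_{m,n}$ is the set of impedances of series-parallel networks containing at most $m$ capacitors and at most $n$ inductors. $\mathcal{N}_{14}$ is the set of all networks of the form $$N_{14}:\quad R_4+\left[\left(R_5+\tfrac1{C_1s}\right)\parallel\left(R_1+\left(L_2s\parallel\left(R_2+\left(\tfrac1{G_3}\parallel L_1s\right)\right)\right)\right)\right]$$ with $R_1,R_4,R_5\ge0$, $R_2>0$, $G_3\ge0$, $C_1,L_1,L_2>0$. $\mathcal{N}_{29}$ is the subclass with $G_3=0$. **Algebra.** $F_0(a,b)$ is the determinant of the $4\times4$ matrix with rows $(b_2,b_1,b_0,0)$, $(a_2,a_1,a_0,0)$, $(0,b_2,b_1,b_0)$, $(0,a_2,a_1,a_0)$. $\mathcal{B}(a,b)$ is the $2\times2$ matrix with $\frac{a(z)b(w)-b(z)a(w)}{z-w}=\sum_{i,j=1}^2\mathcal{B}_{ij}z^{i-1}w^{j-1}$. Define $\alpha(u)=a_0u^2-a_1u+a_2$, $\beta(u)=b_0u^2-b_1u+b_2$,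 $[f_0\ f_1](u)=[u\ \ -1]\,\mathcal{B}(a,b)$, $c_2(u)=uf_1(u)$, $c_1(u)=uf_0(u)+f_1(u)$, $c_0(u)=f_0(u)$, $d_2(u,v)=\beta(u)(b_2-vf_1(u))$, $d_1(u,v)=\beta(u)(b_1-vf_0(u))$, $d_0(u,v)=\beta(u)b_0$, $\eta(u,v)=b_0u^2-(b_1-vf_0(u))u+b_2-vf_1(u)$, and $\gamma_1=c_1d_0-c_0d_1$, $\gamma_2=c_2d_0-c_0d_2$, $\gamma_3=c_2d_1-c_1d_2$, $\lambda_1=d_1\gamma_1-d_0\gamma_2$. Real numbers "have the same sign" if all are non-negative or all are non-positive. **Conditions** (polynomials evaluated at $(\tilde x,\tilde z)$). (Q9) $a_i,b_i\ge0$ for $i=0,1,2$; $\alpha,\beta,\tilde z,d_0,d_1,d_2,f_0,f_1,\lambda_1$ have the same sign; $\gamma_2\ge0$ and $\beta\eta F_0\ge0$; $\eta\ne0$ and $F_0\ne0$. (F5) $d_2=0$. *)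

theory Defs
  imports
    "HOL-Analysis.Analysis"
    "HOL-Computational_Algebra.Polynomial"
    "HOL-Computational_Algebra.Fraction_Field"
begin

section \<open>Series-parallel networks and their impedances\<close>

text \<open>
  Impedances are elements of the field of real rational functions in the indeterminate \<open>s\<close>,
  extended by one infinite value \<^term>\<open>None\<close> (the impedance of an open circuit).
  A resistor is given either by its resistance or by its conductance, so that both the short
  circuit \<open>Resistor 0\<close> and the open circuit \<open>Conductor 0\<close> are available.
\<close>

type_synonym impedance = "real poly fract option"

datatype network =
    Resistor real
  | Conductor real
  | Inductor real
  | Capacitor real
  | Series network network
  | Parallel network network

definition imp_add :: "impedance \<Rightarrow> impedance \<Rightarrow> impedance" where
  "imp_add X Y = (case X of None \<Rightarrow> None | Some x \<Rightarrow>
     (case Y of None \<Rightarrow> None | Some y \<Rightarrow> Some (x + y)))"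

text \<open>The reciprocal interchanges zero and infinity.\<close>

definition imp_recip :: "impedance \<Rightarrow> impedance" where
  "imp_recip X = (case X of None \<Rightarrow> Some 0 | Some x \<Rightarrow> if x = 0 then None else Some (inverse x))"

definition imp_par :: "impedance \<Rightarrow> impedance \<Rightarrow> impedance" where
  "imp_par X Y = imp_recip (imp_add (imp_recip X) (imp_recip Y))"

primrec impedance :: "network \<Rightarrow> impedance" where
  "impedance (Resistor R) = Some (Fract [:R:] 1)"
| "impedance (Conductor G) = imp_recip (Some (Fract [:G:] 1))"
| "impedance (Inductor L) = Some (Fract [:0, L:] 1)"
| "impedance (Capacitor C) = imp_recip (Some (Fract [:0, C:] 1))"
| "impedance (Series M N) = imp_add (impedance M) (impedance N)"
| "impedance (Parallel M N) = imp_par (impedance M) (impedance N)"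

primrec admissible :: "network \<Rightarrow> bool" where
  "admissible (Resistor R) \<longleftrightarrow> R \<ge> 0"
| "admissible (Conductor G) \<longleftrightarrow> G \<ge> 0"
| "admissible (Inductor L) \<longleftrightarrow> L > 0"
| "admissible (Capacitor C) \<longleftrightarrow> C > 0"
| "admissible (Series M N) \<longleftrightarrow> admissible M \<and> admissible N"
| "admissible (Parallel M N) \<longleftrightarrow> admissible M \<and> admissible N"

primrec num_capacitors :: "network \<Rightarrow> nat" where
  "num_capacitors (Resistor R) = 0"
| "num_capacitors (Conductor G) = 0"
| "num_capacitors (Inductor L) = 0"
| "num_capacitors (Capacitor C) = 1"
| "num_capacitors (Series M N) = num_capacitors M + num_capacitors N"
| "num_capacitors (Parallel M N) = num_capacitors M + num_capacitors N"

primrec num_inductors :: "network \<Rightarrow> nat" where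
  "num_inductors (Resistor R) = 0"
| "num_inductors (Conductor G) = 0"
| "num_inductors (Inductor L) = 1"
| "num_inductors (Capacitor C) = 0"
| "num_inductors (Series M N) = num_inductors M + num_inductors N"
| "num_inductors (Parallel M N) = num_inductors M + num_inductors N"

definition is_impedance_of :: "real poly fract \<Rightarrow> network \<Rightarrow> bool" where
  "is_impedance_of Z N \<longleftrightarrow> impedance N = Some Z"

definition Z_class :: "nat \<Rightarrow> nat \<Rightarrow> real poly fract set" where
  "Z_class m n = {Z. \<exists>N. admissible N \<and> num_capacitors N \<le> m \<and> num_inductors N \<le> n
                        \<and> is_impedance_of Z N}"

definition network14 ::
    "real \<Rightarrow> real \<Rightarrow> real \<Rightarrow> real \<Rightarrow> real \<Rightarrow> real \<Rightarrow> real \<Rightarrow> real \<Rightarrow> network" where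
  "network14 R1 R2 G3 R4 R5 C1 L1 L2 =
     Series (Resistor R4)
       (Parallel
         (Series (Resistor R5) (Capacitor C1))
         (Series (Resistor R1)
           (Parallel (Inductor L2)
             (Series (Resistor R2)
               (Parallel (Conductor G3) (Inductor L1))))))"

definition class_N14 :: "network set" where
  "class_N14 = {network14 R1 R2 G3 R4 R5 C1 L1 L2 | R1 R2 G3 R4 R5 C1 L1 L2.
     R1 \<ge> 0 \<and> R4 \<ge> 0 \<and> R5 \<ge> 0 \<and> R2 > 0 \<and> G3 \<ge> 0 \<and> C1 > 0 \<and> L1 > 0 \<and> L2 > 0}"

definition class_N29 :: "network set" where
  "class_N29 = {network14 R1 R2 0 R4 R5 C1 L1 L2 | R1 R2 R4 R5 C1 L1 L2.
     R1 \<ge> 0 \<and> R4 \<ge> 0 \<and> R5 \<ge> 0 \<and> R2 > 0 \<and> C1 > 0 \<and> L1 > 0 \<and> L2 > 0}"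


section \<open>Algebraic quantities attached to a pair of polynomials of degree at most two\<close>

definition F0 :: "real poly \<Rightarrow> real poly \<Rightarrow> real" where
  "F0 a b = det (vector
     [vector [coeff b 2, coeff b 1, coeff b 0, 0],
      vector [coeff a 2, coeff a 1, coeff a 0, 0],
      vector [0, coeff b 2, coeff b 1, coeff b 0],
      vector [0, coeff a 2, coeff a 1, coeff a 0]] :: real^4^4)"

definition bezoutian :: "real poly \<Rightarrow> real poly \<Rightarrow> real^2^2" where
  "bezoutian a b = (THE B. \<forall>z w. z \<noteq> w \<longrightarrow>
     (poly a z * poly b w - poly b z * poly a w) / (z - w)
       = B$1$1 + B$1$2 * w + B$2$1 * z + B$2$2 * z * w)"

text \<open>The description above denotes for polynomials of degree at most two:\<close>

lemma bezoutian_eq: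
  assumes "degree a \<le> 2" "degree b \<le> 2"
  shows "bezoutian a b = vector
     [vector [coeff a 1 * coeff b 0 - coeff a 0 * coeff b 1,
              coeff a 2 * coeff b 0 - coeff a 0 * coeff b 2],
      vector [coeff a 2 * coeff b 0 - coeff a 0 * coeff b 2,
              coeff a 2 * coeff b 1 - coeff a 1 * coeff b 2]]"
    (is "_ = ?B")
proof -
  have poly2: "poly p x = coeff p 0 + coeff p 1 * x + coeff p 2 * x^2"
    if "degree p \<le> 2" for p :: "real poly" and x
  proof -
    have "poly p x = (\<Sum>i\<le>2. coeff p i * x ^ i)"
      unfolding poly_altdef
      by (rule sum.mono_neutral_left) (use that in \<open>auto simp: coeff_eq_0\<close>)
    then show ?thesis
      by (simp add: numeral_2_eq_2)
  qed
  have ex: "\<forall>z w. z \<noteq> w \<longrightarrow>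
     (poly a z * poly b w - poly b z * poly a w) / (z - w)
       = ?B$1$1 + ?B$1$2 * w + ?B$2$1 * z + ?B$2$2 * z * w"
    by (auto simp: poly2 assms field_simps power2_eq_square)
  show ?thesis
    unfolding bezoutian_def
  proof (rule the_equality)
    fix B :: "real^2^2"
    assume B: "\<forall>z w. z \<noteq> w \<longrightarrow>
     (poly a z * poly b w - poly b z * poly a w) / (z - w)
       = B$1$1 + B$1$2 * w + B$2$1 * z + B$2$2 * z * w"
    have E: "B$1$1 + B$1$2 * w + B$2$1 * z + B$2$2 * z * w
       = ?B$1$1 + ?B$1$2 * w + ?B$2$1 * z + ?B$2$2 * z * w" if "z \<noteq> w" for z w
      using B ex that by metis
    show "B = ?B"
      using E[of 0 1] E[of 1 0] E[of 0 2] E[of 2 1]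
      by (simp add: vec_eq_iff forall_2 algebra_simps)
  qed (rule ex)
qed

text \<open>
  The polynomials in \<open>u\<close>, respectively in \<open>u\<close> and \<open>v\<close>, are represented by the real functions
  they induce.
\<close>

definition alpha :: "real poly \<Rightarrow> real poly \<Rightarrow> real \<Rightarrow> real" where
  "alpha a b u = coeff a 0 * u^2 - coeff a 1 * u + coeff a 2"

definition beta :: "real poly \<Rightarrow> real poly \<Rightarrow> real \<Rightarrow> real" where
  "beta a b u = coeff b 0 * u^2 - coeff b 1 * u + coeff b 2"

definition f0 :: "real poly \<Rightarrow> real poly \<Rightarrow> real \<Rightarrow> real" where
  "f0 a b u = ((vector [u, -1] :: real^2) v* bezoutian a b) $ 1"

definition f1 :: "real poly \<Rightarrow> real poly \<Rightarrow> real \<Rightarrow> real" where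
  "f1 a b u = ((vector [u, -1] :: real^2) v* bezoutian a b) $ 2"

definition c2 :: "real poly \<Rightarrow> real poly \<Rightarrow> real \<Rightarrow> real" where
  "c2 a b u = u * f1 a b u"

definition c1 :: "real poly \<Rightarrow> real poly \<Rightarrow> real \<Rightarrow> real" where
  "c1 a b u = u * f0 a b u + f1 a b u"

definition c0 :: "real poly \<Rightarrow> real poly \<Rightarrow> real \<Rightarrow> real" where
  "c0 a b u = f0 a b u"

definition d2 :: "real poly \<Rightarrow> real poly \<Rightarrow> real \<Rightarrow> real \<Rightarrow> real" where
  "d2 a b u v = beta a b u * (coeff b 2 - v * f1 a b u)"

definition d1 :: "real poly \<Rightarrow> real poly \<Rightarrow> real \<Rightarrow> real \<Rightarrow> real" where
  "d1 a b u v = beta a b u * (coeff b 1 - v * f0 a b u)"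

definition d0 :: "real poly \<Rightarrow> real poly \<Rightarrow> real \<Rightarrow> real \<Rightarrow> real" where
  "d0 a b u v = beta a b u * coeff b 0"

definition eta :: "real poly \<Rightarrow> real poly \<Rightarrow> real \<Rightarrow> real \<Rightarrow> real" where
  "eta a b u v = coeff b 0 * u^2 - (coeff b 1 - v * f0 a b u) * u + coeff b 2 - v * f1 a b u"

definition gamma1 :: "real poly \<Rightarrow> real poly \<Rightarrow> real \<Rightarrow> real \<Rightarrow> real" where
  "gamma1 a b u v = c1 a b u * d0 a b u v - c0 a b u * d1 a b u v"

definition gamma2 :: "real poly \<Rightarrow> real poly \<Rightarrow> real \<Rightarrow> real \<Rightarrow> real" where
  "gamma2 a b u v = c2 a b u * d0 a b u v - c0 a b u * d2 a b u v"

definition gamma3 :: "real poly \<Rightarrow> real poly \<Rightarrow> real \<Rightarrow> real \<Rightarrow> real" where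
  "gamma3 a b u v = c2 a b u * d1 a b u v - c1 a b u * d2 a b u v"

definition lambda1 :: "real poly \<Rightarrow> real poly \<Rightarrow> real \<Rightarrow> real \<Rightarrow> real" where
  "lambda1 a b u v = d1 a b u v * gamma1 a b u v - d0 a b u v * gamma2 a b u v"

definition same_sign :: "real set \<Rightarrow> bool" where
  "same_sign S \<longleftrightarrow> (\<forall>x\<in>S. x \<ge> 0) \<or> (\<forall>x\<in>S. x \<le> 0)"

definition cond_Q9 :: "real poly \<Rightarrow> real poly \<Rightarrow> real \<Rightarrow> real \<Rightarrow> bool" where
  "cond_Q9 a b x z \<longleftrightarrow>
     (\<forall>i\<in>{0,1,2}. coeff a i \<ge> 0 \<and> coeff b i \<ge> 0) \<and>
     same_sign {alpha a b x, beta a b x, z, d0 a b x z, d1 a b x z, d2 a b x z,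
                f0 a b x, f1 a b x, lambda1 a b x z} \<and>
     gamma2 a b x z \<ge> 0 \<and> beta a b x * eta a b x z * F0 a b \<ge> 0 \<and>
     eta a b x z \<noteq> 0 \<and> F0 a b \<noteq> 0"

definition cond_F5 :: "real poly \<Rightarrow> real poly \<Rightarrow> real \<Rightarrow> real \<Rightarrow> bool" where
  "cond_F5 a b x z \<longleftrightarrow> d2 a b x z = 0"

end

theory Submission
  imports Defs
    "HOL-Computational_Algebra.Polynomial_Factorial"
    "HOL-Computational_Algebra.Field_as_Ring"
begin

text \<open>
  Removing \<open>R4 = Z(-1/x)\<close> and then the branch \<open>R5 + 1/(C1 s)\<close> with \<open>R5 C1 = x\<close> leaves the impedance
  \<open>c/d\<close> with \<open>c = (x s + 1) (f1 s + f0)\<close> and \<open>d = \<beta> (b - z s (f1 s + f0))\<close>. Extracting \<open>R1\<close>,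
  \<open>L2\<close>, \<open>R2\<close>, \<open>L1\<close>, \<open>G3\<close> from \<open>c/d\<close> in turn gives the element values; their signs follow from
  \<open>\<gamma>1 \<gamma>3 - \<gamma>2\<^sup>2 = \<beta>\<^sup>3 \<eta> F0 > 0\<close>, i.e. from \<open>c/d\<close> having a positive definite Bezoutian.

  Conversely, for a network from \<open>N14\<close> with a biquadratic impedance the cancellation forces
  \<open>x s + 1\<close> to divide \<open>c\<close>, so that (Q9) holds at \<open>x = R5 C1\<close>, \<open>z = C1/\<beta>\<close>. Evaluating the
  Bezoutian of \<open>c\<close> and \<open>d\<close> at the zero \<open>- f0/f1\<close> of \<open>c\<close> shows that \<open>F0\<close> and \<open>x f0 - f1\<close> have
  the same strict sign. If it is positive, then the Bezoutian of \<open>a\<close> and \<open>b\<close> is positive definite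
  and \<open>Z\<close> itself is an RL impedance with two inductors. If it is negative, then \<open>z\<close> can be
  moved to \<open>b2/f1\<close>, where \<open>d2 = 0\<close>, without leaving (Q9).
\<close>

section \<open>Impedances of the inner RL network and of N14\<close>

lemma imp_recip_Fract:
  "p \<noteq> 0 \<Longrightarrow> q \<noteq> 0 \<Longrightarrow> imp_recip (Some (Fract p q)) = Some (Fract q p)"
  by (simp add: imp_recip_def eq_fract Zero_fract_def)

lemma imp_add_Fract:
  "q \<noteq> 0 \<Longrightarrow> s \<noteq> 0 \<Longrightarrow>
    imp_add (Some (Fract p q)) (Some (Fract r s)) = Some (Fract (p * s + r * q) (q * s))"
  by (simp add: imp_add_def)

lemma imp_par_Fract:
  assumes "p \<noteq> 0" "q \<noteq> 0" "r \<noteq> 0" "s \<noteq> 0" "q * r + s * p \<noteq> 0"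
  shows "imp_par (Some (Fract p q)) (Some (Fract r s)) = Some (Fract (p * r) (q * r + s * p))"
  using assms by (simp add: imp_par_def imp_recip_Fract imp_add_Fract)

lemma imp_recip_imp_recip [simp]: "imp_recip (imp_recip X) = X"
  by (cases X) (auto simp: imp_recip_def)

lemma Fract_eqI: "q \<noteq> 0 \<Longrightarrow> s \<noteq> 0 \<Longrightarrow> p * s = r * q \<Longrightarrow> Fract p q = Fract r s"
  by (simp add: eq_fract)

text \<open>The branch of \<open>N14\<close> parallel to \<open>R5\<close> and \<open>C1\<close>. On
  its own it has two inductors and no capacitor, so it also realizes members of
  \<open>Z_class 0 2\<close>.\<close>

definition rl_network :: "real \<Rightarrow> real \<Rightarrow> real \<Rightarrow> real \<Rightarrow> real \<Rightarrow> network" where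
  "rl_network R1 R2 G3 L1 L2 =
     Series (Resistor R1)
       (Parallel (Inductor L2) (Series (Resistor R2) (Parallel (Conductor G3) (Inductor L1))))"

lemma impedance_rl_network:
  assumes "R2 > 0" "G3 \<ge> 0" "L1 > 0" "L2 > 0"
  shows "impedance (rl_network R1 R2 G3 L1 L2) = Some (Fract
    [:R1 * R2, R1 * ((1 + R2 * G3) * L1 + L2) + L2 * R2, R1 * (G3 * L1 * L2) + L2 * ((1 + R2 * G3) * L1):]
    [:R2, (1 + R2 * G3) * L1 + L2, G3 * L1 * L2:])" (is "_ = Some (Fract ?c ?d)")
proof -
  let ?e = "[:R2, (1 + R2 * G3) * L1:]" and ?g = "[:1, G3 * L1:]"
  have 1: "impedance (Parallel (Conductor G3) (Inductor L1)) = Some (Fract [:0, L1:] ?g)"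
    using assms by (simp add: imp_par_def imp_recip_Fract imp_add_Fract one_pCons ac_simps)
  have 2: "impedance (Series (Resistor R2) (Parallel (Conductor G3) (Inductor L1))) = Some (Fract ?e ?g)"
    using assms unfolding impedance.simps(5) 1
    by (simp add: imp_add_Fract algebra_simps)
  have 3: "impedance (Parallel (Inductor L2) (Series (Resistor R2) (Parallel (Conductor G3) (Inductor L1))))
      = Some (Fract ([:0, L2:] * ?e) (1 * ?e + ?g * [:0, L2:]))"
    unfolding impedance.simps(6) 2 impedance.simps(3)
    using assms by (intro imp_par_Fract) auto
  have 4: "1 * ?e + ?g * [:0, L2:] = ?d"
    by (simp add: algebra_simps)
  have 5: "[:R1:] * ?d + [:0, L2:] * ?e * 1 = ?c"
    by (simp add: algebra_simps)
  have "impedance (rl_network R1 R2 G3 L1 L2) = Some (Fract ([:R1:] * ?d + [:0, L2:] * ?e * 1) (1 * ?d))"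
    unfolding rl_network_def impedance.simps(5)[of "Resistor R1"] 3 4 impedance.simps(1)
    using assms by (intro imp_add_Fract) auto
  then show ?thesis unfolding 5 by simp
qed

text \<open>The fraction \<open>c/d\<close> of the RL branch may be any representative: one written
  in element values, or a multiple built from \<open>a\<close> and \<open>b\<close>.\<close>

lemma impedance_network14:
  assumes rl: "impedance (rl_network R1 R2 G3 L1 L2) = Some (Fract c d)"
    and "C1 > 0" "c \<noteq> 0" "d \<noteq> 0" and Q: "Q = [:0, C1:] * c + d * [:1, R5 * C1:]" "Q \<noteq> 0"
  shows "impedance (network14 R1 R2 G3 R4 R5 C1 L1 L2)
    = Some (Fract (smult R4 Q + [:1, R5 * C1:] * c) Q)"
proof -
  let ?X = "[:1, R5 * C1:]"
  have 1: "impedance (Series (Resistor R5) (Capacitor C1)) = Some (Fract ?X [:0, C1:])"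
    using assms by (simp add: imp_recip_Fract imp_add_Fract one_pCons ac_simps)
  have "impedance (Parallel (Series (Resistor R5) (Capacitor C1)) (rl_network R1 R2 G3 L1 L2))
      = Some (Fract (?X * c) ([:0, C1:] * c + d * ?X))"
    unfolding impedance.simps(6) 1 rl using assms by (intro imp_par_Fract) auto
  then have 2: "impedance (Parallel (Series (Resistor R5) (Capacitor C1)) (rl_network R1 R2 G3 L1 L2))
      = Some (Fract (?X * c) Q)" unfolding Q .
  have "impedance (network14 R1 R2 G3 R4 R5 C1 L1 L2) = Some (Fract ([:R4:] * Q + ?X * c * 1) (1 * Q))"
    unfolding network14_def rl_network_def[symmetric] impedance.simps(5)[of "Resistor R4"] 2 impedance.simps(1)
    using assms by (intro imp_add_Fract) auto
  then show ?thesis by simp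
qed

text \<open>This is the Cauer-type extraction: remove the value at \<open>0\<close>, then the pole of the
  admittance at \<open>0\<close>, and repeat.\<close>

lemma impedance_rl_realization:
  fixes c0 c1 c2 d0 d1 d2 :: real
  assumes g1: "g1 = c1 * d0 - c0 * d1" and g2: "g2 = c2 * d0 - c0 * d2"
    and l: "l = d1 * g1 - d0 * g2" and P: "d0 * P = l * g2 - g1^2 * d2"
    and pos: "d0 * l > 0" "d2 * l \<ge> 0" "P > 0" "g1 > 0"
  shows "impedance (rl_network (c0 / d0) (g1^2 / (d0 * l)) (d2 * l / P) (P * g1 / l^2) (g1 / d0^2))
    = Some (Fract [:c0, c1, c2:] [:d0, d1, d2:])"
proof -
  have nz: "d0 \<noteq> 0" "l \<noteq> 0" using pos by auto
  \<comment> \<open>Common factor between the coefficients in \<open>impedance_rl_network\<close> at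
    these element values and the prescribed ones.\<close>
  define k where "k = g1^2 / (d0^2 * l)"
  have k: "k \<noteq> 0" using nz pos by (simp add: k_def)
  let ?R1 = "c0 / d0" and ?R2 = "g1^2 / (d0 * l)" and ?G3 = "d2 * l / P"
    and ?L1 = "P * g1 / l^2" and ?L2 = "g1 / d0^2"
  have D0: "?R2 = k * d0" using nz by (simp add: k_def power2_eq_square)
  have D2: "?G3 * ?L1 * ?L2 = k * d2"
    using nz pos by (simp add: k_def power2_eq_square ac_simps)
  \<comment> \<open>The identity \<open>P\<close> enters here: it merges the two terms of
    \<open>1 + R2 * G3\<close> into the single product \<open>l * g2\<close>.\<close>
  have E: "(1 + ?R2 * ?G3) * ?L1 = g1 * g2 / (l * d0)"
  proof -
    have "(1 + ?R2 * ?G3) * ?L1 = g1 * (d0 * P + g1^2 * d2) / (l^2 * d0)"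
      using nz pos by (simp add: field_simps power2_eq_square)
    also have "d0 * P + g1^2 * d2 = l * g2" using P by simp
    finally show ?thesis using nz by (simp add: power2_eq_square)
  qed
  have D1: "(1 + ?R2 * ?G3) * ?L1 + ?L2 = k * d1"
  proof -
    have "g1 * g2 / (l * d0) = g1 * (d0 * g2) / (d0^2 * l)" "?L2 = g1 * l / (d0^2 * l)"
      using nz by (simp_all add: power2_eq_square)
    then have "g1 * g2 / (l * d0) + ?L2 = g1 * (d0 * g2 + l) / (d0^2 * l)"
      by (simp only: distrib_left add_divide_distrib)
    also have "d0 * g2 + l = d1 * g1" using l by simp
    finally show ?thesis unfolding E by (simp add: k_def power2_eq_square)
  qed
  have C0: "?R1 * (k * d0) = k * c0" using nz by simp
  have C1: "?R1 * (k * d1) + ?L2 * (k * d0) = k * c1"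
    using nz by (simp add: field_simps power2_eq_square) (simp add: g1 algebra_simps)
  have "?L2 * (g1 * g2 / (l * d0)) = k * (g2 / d0)"
    using nz by (simp add: k_def power2_eq_square)
  moreover have "?R1 * (k * d2) + k * (g2 / d0) = k * c2"
    using nz by (simp add: g2 field_simps)
  ultimately have C2: "?R1 * (k * d2) + ?L2 * (g1 * g2 / (l * d0)) = k * c2"
    by simp
  have "?R2 > 0" "?L1 > 0" "?L2 > 0" "?G3 \<ge> 0"
    using pos nz by auto
  from impedance_rl_network[OF this(1,4,2,3), of ?R1]
  have "impedance (rl_network ?R1 ?R2 ?G3 ?L1 ?L2) = Some (Fract
      [:k * c0, k * c1, k * c2:] [:k * d0, k * d1, k * d2:])"
    \<comment> \<open>\<open>D1\<close> contains the left side of \<open>E\<close>, and both contain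
      that of \<open>D0\<close>, so the larger expressions are rewritten first.\<close>
    unfolding D1 D2 unfolding E unfolding D0 C0 C1 C2 .
  moreover have "Fract [:k * c0, k * c1, k * c2:] [:k * d0, k * d1, k * d2:]
      = Fract [:c0, c1, c2:] [:d0, d1, d2:]"
    using k nz by (intro Fract_eqI) (auto simp: algebra_simps)
  ultimately show ?thesis by simp
qed

section \<open>Determinants and resultants\<close>

lemma det_4:
  fixes A :: "'a::comm_ring_1^4^4"
  shows "det A =
    A$1$1 * A$2$2 * A$3$3 * A$4$4 - A$1$1 * A$2$2 * A$3$4 * A$4$3
  - A$1$1 * A$2$3 * A$3$2 * A$4$4 + A$1$1 * A$2$3 * A$3$4 * A$4$2
  + A$1$1 * A$2$4 * A$3$2 * A$4$3 - A$1$1 * A$2$4 * A$3$3 * A$4$2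
  - A$1$2 * A$2$1 * A$3$3 * A$4$4 + A$1$2 * A$2$1 * A$3$4 * A$4$3
  + A$1$2 * A$2$3 * A$3$1 * A$4$4 - A$1$2 * A$2$3 * A$3$4 * A$4$1
  - A$1$2 * A$2$4 * A$3$1 * A$4$3 + A$1$2 * A$2$4 * A$3$3 * A$4$1
  + A$1$3 * A$2$1 * A$3$2 * A$4$4 - A$1$3 * A$2$1 * A$3$4 * A$4$2
  - A$1$3 * A$2$2 * A$3$1 * A$4$4 + A$1$3 * A$2$2 * A$3$4 * A$4$1
  + A$1$3 * A$2$4 * A$3$1 * A$4$2 - A$1$3 * A$2$4 * A$3$2 * A$4$1
  - A$1$4 * A$2$1 * A$3$2 * A$4$3 + A$1$4 * A$2$1 * A$3$3 * A$4$2
  + A$1$4 * A$2$2 * A$3$1 * A$4$3 - A$1$4 * A$2$2 * A$3$3 * A$4$1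
  - A$1$4 * A$2$3 * A$3$1 * A$4$2 + A$1$4 * A$2$3 * A$3$2 * A$4$1"
proof -
  have f234: "finite {2::4, 3, 4}" "1 \<notin> {2::4, 3, 4}"
    and f34: "finite {3::4, 4}" "2 \<notin> {3::4, 4}"
    and f4: "finite {4::4}" "3 \<notin> {4::4}"
    by auto
  show ?thesis
    unfolding det_def UNIV_4
    unfolding sum_over_permutations_insert[OF f234]
    unfolding sum_over_permutations_insert[OF f34]
    unfolding sum_over_permutations_insert[OF f4]
    unfolding permutes_sing
    by (simp add: sign_swap_id permutation_swap_id sign_compose permutation_compose
        sign_id swap_id_eq algebra_simps)
qed

text \<open>This is the determinant of the Bezoutian matrix, so \<open>F0 > 0\<close> means that the
  Bezoutian is definite.\<close>

lemma F0_eq: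
  "F0 a b = (coeff a 1 * coeff b 0 - coeff a 0 * coeff b 1) * (coeff a 2 * coeff b 1 - coeff a 1 * coeff b 2)
     - (coeff a 2 * coeff b 0 - coeff a 0 * coeff b 2)^2"
  unfolding F0_def det_4 by (simp add: vector_def algebra_simps power2_eq_square)

section \<open>Identities between the quantities attached to \<open>a\<close> and
  \<open>b\<close>\<close>

context
  fixes a b :: "real poly"
  assumes deg: "degree a \<le> 2" "degree b \<le> 2"
begin

text \<open>This and the next two lemmas are the coefficients of
  \<open>(u s + 1) (f1 s + f0) = beta a - alpha b\<close>; for nonzero \<open>u\<close> the right
  side vanishes at \<open>s = -1/u\<close>.\<close>

lemma f0_eq: "f0 a b u = coeff a 0 * beta a b u - alpha a b u * coeff b 0"
  using deg by (simp add: f0_def alpha_def beta_def bezoutian_eq vector_matrix_mult_def sum_2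
      algebra_simps power2_eq_square)

lemma u_f1_eq: "u * f1 a b u = coeff a 2 * beta a b u - alpha a b u * coeff b 2"
  using deg by (simp add: f1_def alpha_def beta_def bezoutian_eq vector_matrix_mult_def sum_2
      algebra_simps power2_eq_square)

lemma u_f0_f1_eq: "u * f0 a b u + f1 a b u = coeff a 1 * beta a b u - alpha a b u * coeff b 1"
  using deg by (simp add: f0_def f1_def alpha_def beta_def bezoutian_eq vector_matrix_mult_def sum_2
      algebra_simps power2_eq_square)

lemma f0_bezout: "f0 a b u = u * (coeff a 1 * coeff b 0 - coeff a 0 * coeff b 1)
    - (coeff a 2 * coeff b 0 - coeff a 0 * coeff b 2)"
  using deg by (simp add: f0_def bezoutian_eq vector_matrix_mult_def sum_2 algebra_simps)

lemma f1_bezout: "f1 a b u = u * (coeff a 2 * coeff b 0 - coeff a 0 * coeff b 2)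
    - (coeff a 2 * coeff b 1 - coeff a 1 * coeff b 2)"
  using deg by (simp add: f1_def bezoutian_eq vector_matrix_mult_def sum_2 algebra_simps)

text \<open>The left-hand side is the resultant of \<open>f1 s + f0\<close> and \<open>b\<close>.\<close>

lemma resultant_f_b:
  "coeff b 0 * (f1 a b u)^2 - coeff b 1 * f0 a b u * f1 a b u + coeff b 2 * (f0 a b u)^2
    = - beta a b u * F0 a b"
  unfolding f0_bezout f1_bezout F0_eq beta_def by algebra

text \<open>Up to sign, both sides are the resultant of \<open>c\<close> and \<open>d\<close>, which factor over
  \<open>(u s + 1) (f1 s + f0)\<close> and \<open>\<beta> (b - v s (f1 s + f0))\<close>.\<close>

lemma resultant_c_d:
  "gamma1 a b u v * gamma3 a b u v - (gamma2 a b u v)^2 = (beta a b u)^3 * eta a b u v * F0 a b"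
proof -
  have "gamma1 a b u v * gamma3 a b u v - (gamma2 a b u v)^2
    = - ((beta a b u)^2) * eta a b u v *
      (coeff b 0 * (f1 a b u)^2 - coeff b 1 * f0 a b u * f1 a b u + coeff b 2 * (f0 a b u)^2)"
    unfolding gamma1_def gamma2_def gamma3_def c0_def c1_def c2_def d0_def d1_def d2_def eta_def
    by algebra
  also have "\<dots> = (beta a b u)^3 * eta a b u v * F0 a b"
    unfolding resultant_f_b by algebra
  finally show ?thesis .
qed

text \<open>Follows from the syzygy \<open>d0 * gamma3 - d1 * gamma2 + d2 * gamma1 = 0\<close> of
  minors. It is the identity that the Cauer extraction requires of its parameter
  \<open>P\<close>.\<close>

lemma d0_resultant:
  "d0 a b u v * ((beta a b u)^3 * eta a b u v * F0 a b)
    = lambda1 a b u v * gamma2 a b u v - (gamma1 a b u v)^2 * d2 a b u v"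
  unfolding resultant_c_d[symmetric] lambda1_def gamma1_def gamma2_def gamma3_def by algebra

text \<open>The Bezoutian form of \<open>c\<close> and \<open>d\<close> at the zero \<open>- f0 / f1\<close> of \<open>c\<close>, cleared of denominators.\<close>

lemma gamma_form_at_zero:
  "(f1 a b u)^2 * gamma1 a b u v - 2 * f0 a b u * f1 a b u * gamma2 a b u v
      + (f0 a b u)^2 * gamma3 a b u v
    = (beta a b u)^2 * F0 a b * (u * f0 a b u - f1 a b u)"
proof -
  have "(f1 a b u)^2 * gamma1 a b u v - 2 * f0 a b u * f1 a b u * gamma2 a b u v
      + (f0 a b u)^2 * gamma3 a b u v
    = beta a b u * (f1 a b u - u * f0 a b u) *
      (coeff b 0 * (f1 a b u)^2 - coeff b 1 * f0 a b u * f1 a b u + coeff b 2 * (f0 a b u)^2)"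
    unfolding gamma1_def gamma2_def gamma3_def c0_def c1_def c2_def d0_def d1_def d2_def
    by algebra
  also have "\<dots> = (beta a b u)^2 * F0 a b * (u * f0 a b u - f1 a b u)"
    unfolding resultant_f_b by algebra
  finally show ?thesis .
qed

end

section \<open>Consequences of condition (Q9)\<close>

lemma same_sign_mult_nonneg: "same_sign S \<Longrightarrow> x \<in> S \<Longrightarrow> y \<in> S \<Longrightarrow> (0::real) \<le> x * y"
  unfolding same_sign_def by (auto simp: mult_nonpos_nonpos)

lemma same_signI: "w \<noteq> 0 \<Longrightarrow> (\<And>y. y \<in> S \<Longrightarrow> 0 \<le> w * y) \<Longrightarrow> same_sign S"
  unfolding same_sign_def by (cases "w > 0") (auto simp: zero_le_mult_iff)

text \<open>From \<open>d0 * (g1 * g3 - g2^2) = l * g2 - g1^2 * d2\<close> with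
  \<open>d0 > 0\<close>, the product \<open>l * g2\<close> is positive, and then
  \<open>d1 * g1 = l + d0 * g2\<close> gives \<open>g1 > 0\<close>. If \<open>d0 = 0\<close>, then
  \<open>g1 <= 0 <= g3\<close>, against \<open>g1 * g3 > 0\<close>.\<close>

lemma cauer_positive_nonneg:
  fixes c0 c1 c2 d0 d1 d2 :: real
  assumes nonneg: "c0 \<ge> 0" "c1 \<ge> 0" "c2 \<ge> 0" "d0 \<ge> 0" "d1 \<ge> 0" "d2 \<ge> 0" "l \<ge> 0" "g2 \<ge> 0"
    and g: "g1 = c1 * d0 - c0 * d1" "g2 = c2 * d0 - c0 * d2" "g3 = c2 * d1 - c1 * d2"
    and l: "l = d1 * g1 - d0 * g2" and P: "g1 * g3 - g2^2 > 0"
  shows "d0 * l > 0 \<and> g1 > 0 \<and> g2 > 0"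
proof -
  have prod: "g1 * g3 > 0" using P zero_le_power2[of g2] by linarith
  have "d0 \<noteq> 0"
  proof
    assume [simp]: "d0 = 0"
    have "g1 \<le> 0" "c0 * d2 \<le> 0" using nonneg g by auto
    moreover have "c0 \<noteq> 0" using prod g by auto
    ultimately have "d2 = 0" using nonneg by (auto simp: mult_le_0_iff)
    then have "g3 \<ge> 0" using nonneg g by simp
    with \<open>g1 \<le> 0\<close> prod show False by (simp add: zero_less_mult_iff)
  qed
  with nonneg have d0: "d0 > 0" by simp
  have "l * g2 - g1^2 * d2 = d0 * (g1 * g3 - g2^2)"
    unfolding l g by algebra
  with d0 P have "l * g2 - g1^2 * d2 > 0" by simp
  moreover have "g1^2 * d2 \<ge> 0" using nonneg by simp
  ultimately have "l * g2 > 0" by linarith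
  with nonneg have lg: "l > 0" "g2 > 0" by (auto simp: zero_less_mult_iff)
  have "d1 * g1 = l + d0 * g2" using l by simp
  with lg d0 have "d1 * g1 > 0" by (simp add: add_pos_pos)
  with nonneg have "g1 > 0" by (auto simp: zero_less_mult_iff)
  with lg d0 show ?thesis by simp
qed

text \<open>Negating all coefficients of \<open>c\<close> and \<open>d\<close> preserves the minors
  and negates \<open>l\<close>, so the nonpositive case reduces to the nonnegative one.\<close>

lemma cauer_positive:
  fixes c0 c1 c2 d0 d1 d2 :: real
  assumes ss: "same_sign {c0, c1, c2, d0, d1, d2, l}" and "g2 \<ge> 0"
    and g: "g1 = c1 * d0 - c0 * d1" "g2 = c2 * d0 - c0 * d2" "g3 = c2 * d1 - c1 * d2"
    and l: "l = d1 * g1 - d0 * g2" and P: "g1 * g3 - g2^2 > 0"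
  shows "d0 * l > 0 \<and> g1 > 0 \<and> g2 > 0"
proof -
  from ss consider "c0 \<ge> 0" "c1 \<ge> 0" "c2 \<ge> 0" "d0 \<ge> 0" "d1 \<ge> 0" "d2 \<ge> 0" "l \<ge> 0"
    | "c0 \<le> 0" "c1 \<le> 0" "c2 \<le> 0" "d0 \<le> 0" "d1 \<le> 0" "d2 \<le> 0" "l \<le> 0"
    unfolding same_sign_def by auto
  then show ?thesis
  proof cases
    case 1
    from this \<open>g2 \<ge> 0\<close> g l P show ?thesis by (rule cauer_positive_nonneg)
  next
    case 2
    then have "0 \<le> - c0" "0 \<le> - c1" "0 \<le> - c2" "0 \<le> - d0" "0 \<le> - d1" "0 \<le> - d2" "0 \<le> - l"
      by simp_all
    moreover note \<open>g2 \<ge> 0\<close>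
    moreover have "g1 = - c1 * - d0 - - c0 * - d1" "g2 = - c2 * - d0 - - c0 * - d2"
      "g3 = - c2 * - d1 - - c1 * - d2" "- l = - d1 * g1 - - d0 * g2"
      by (simp_all add: g(1-3) l)
    ultimately have "(- d0) * (- l) > 0 \<and> g1 > 0 \<and> g2 > 0"
      using P by (rule cauer_positive_nonneg)
    then show ?thesis by simp
  qed
qed

text \<open>If \<open>beta\<close> vanished, \<open>(x s + 1) (f1 s + f0)\<close> would equal
  \<open>- alpha b\<close>. Multiplied by \<open>alpha\<close>, the left side has nonnegative and
  the right side nonpositive coefficients, so \<open>alpha = 0\<close> or \<open>b = 0\<close>; both
  force \<open>F0 = 0\<close>.\<close>

lemma cond_Q9_beta_nonzero:
  assumes deg: "degree a \<le> 2" "degree b \<le> 2" and Q: "cond_Q9 a b x z" and "x \<ge> 0"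
  shows "beta a b x \<noteq> 0"
proof
  assume B: "beta a b x = 0"
  have S: "same_sign {alpha a b x, beta a b x, z, d0 a b x z, d1 a b x z, d2 a b x z,
                f0 a b x, f1 a b x, lambda1 a b x z}"
    and b: "coeff b 0 \<ge> 0" "coeff b 1 \<ge> 0" "coeff b 2 \<ge> 0" and "F0 a b \<noteq> 0"
    using Q by (auto simp: cond_Q9_def)
  have s0: "alpha a b x * f0 a b x \<ge> 0" and s1: "alpha a b x * f1 a b x \<ge> 0"
    by (rule same_sign_mult_nonneg[OF S]; simp)+
  let ?A = "(alpha a b x)^2"
  have "alpha a b x \<noteq> 0"
  proof
    assume "alpha a b x = 0"
    then have "f0 a b x = 0" "x * f0 a b x + f1 a b x = 0"
      using f0_eq[OF deg, of x] u_f0_f1_eq[OF deg, of x] B by simp_all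
    then have "f0 a b x = 0" "f1 a b x = 0" by auto
    \<comment> \<open>The nonzero row \<open>[x, -1]\<close> lies in the left kernel of the
      Bezoutian matrix, whose determinant is \<open>F0\<close>.\<close>
    then have "F0 a b = 0"
      unfolding f0_bezout[OF deg] f1_bezout[OF deg] F0_eq by algebra
    with \<open>F0 a b \<noteq> 0\<close> show False ..
  qed
  then have A: "?A > 0" by simp
  have "alpha a b x * f0 a b x = - (?A * coeff b 0)"
    unfolding f0_eq[OF deg] B by algebra
  then have b0: "coeff b 0 = 0" using s0 A b by (simp add: mult_le_0_iff)
  have "alpha a b x * (x * f1 a b x) = - (?A * coeff b 2)"
    unfolding u_f1_eq[OF deg] B by algebra
  moreover have "alpha a b x * (x * f1 a b x) \<ge> 0"
    using mult_nonneg_nonneg[OF \<open>x \<ge> 0\<close> s1] by (simp add: ac_simps)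
  ultimately have b2: "coeff b 2 = 0" using A b by (simp add: mult_le_0_iff)
  have "alpha a b x * (x * f0 a b x + f1 a b x) = - (?A * coeff b 1)"
    unfolding u_f0_f1_eq[OF deg] B by algebra
  moreover have "alpha a b x * (x * f0 a b x + f1 a b x) \<ge> 0"
    using mult_nonneg_nonneg[OF \<open>x \<ge> 0\<close> s0] s1 by (simp add: algebra_simps)
  ultimately have b1: "coeff b 1 = 0" using A b by (simp add: mult_le_0_iff)
  from b0 b1 b2 have "F0 a b = 0" by (simp add: F0_eq)
  with \<open>F0 a b \<noteq> 0\<close> show False ..
qed

lemma cond_Q9_imp:
  assumes deg: "degree a \<le> 2" "degree b \<le> 2" and Q: "cond_Q9 a b x z" and "x \<ge> 0"
  shows "(beta a b x)^3 * eta a b x z * F0 a b > 0"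
    and "d0 a b x z * lambda1 a b x z > 0" and "gamma1 a b x z > 0" and "gamma2 a b x z > 0"
proof -
  have B: "beta a b x \<noteq> 0" by (rule cond_Q9_beta_nonzero[OF assms])
  have S: "same_sign {alpha a b x, beta a b x, z, d0 a b x z, d1 a b x z, d2 a b x z,
                f0 a b x, f1 a b x, lambda1 a b x z}"
    using Q by (simp add: cond_Q9_def)
  have "beta a b x * eta a b x z * F0 a b \<ge> 0" "beta a b x * eta a b x z * F0 a b \<noteq> 0"
    using Q B by (auto simp: cond_Q9_def)
  then have "beta a b x * eta a b x z * F0 a b > 0" by (metis order_le_neq_trans)
  moreover have "(beta a b x)^2 > 0" using B by simp
  ultimately have "(beta a b x)^2 * (beta a b x * eta a b x z * F0 a b) > 0"
    by (rule mult_pos_pos[rotated])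
  also have "(beta a b x)^2 * (beta a b x * eta a b x z * F0 a b)
      = (beta a b x)^3 * eta a b x z * F0 a b" by algebra
  finally show P: "(beta a b x)^3 * eta a b x z * F0 a b > 0" .
  \<comment> \<open>Since \<open>x >= 0\<close>, the signs of \<open>f0\<close> and
    \<open>f1\<close> pass to \<open>c1\<close> and \<open>c2\<close>.\<close>
  have "same_sign {c0 a b x, c1 a b x, c2 a b x, d0 a b x z, d1 a b x z, d2 a b x z, lambda1 a b x z}"
    using S \<open>x \<ge> 0\<close> unfolding same_sign_def c0_def c1_def c2_def
    by (auto simp: add_nonpos_nonpos mult_nonneg_nonpos)
  moreover have "gamma2 a b x z \<ge> 0" using Q by (simp add: cond_Q9_def)
  ultimately have "d0 a b x z * lambda1 a b x z > 0 \<and> gamma1 a b x z > 0 \<and> gamma2 a b x z > 0"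
    using gamma1_def gamma2_def gamma3_def lambda1_def P
    unfolding resultant_c_d[OF deg, symmetric] by (rule cauer_positive)
  then show "d0 a b x z * lambda1 a b x z > 0" "gamma1 a b x z > 0" "gamma2 a b x z > 0" by auto
qed

section \<open>Realization by \<open>N14\<close> under (Q9)\<close>

lemma poly_degree_le_2: "degree p \<le> 2 \<Longrightarrow> p = [:coeff p 0, coeff p 1, coeff p 2:]"
  by (rule poly_eqI) (auto simp: coeff_pCons coeff_eq_0 numeral_2_eq_2 split: nat.split)

lemma d2_lambda1_nonneg:
  assumes "cond_Q9 a b x z"
  shows "d2 a b x z * lambda1 a b x z \<ge> 0"
  using assms unfolding cond_Q9_def by (auto elim!: same_sign_mult_nonneg)

text \<open>Putting \<open>R5\<close> and \<open>C1\<close> in parallel with \<open>c/d\<close>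
  gives the denominator \<open>beta (x s + 1) b\<close>, adding \<open>R4\<close> in series gives
  the numerator \<open>beta (x s + 1) a\<close>, and the common factor cancels.\<close>

lemma cond_Q9_impedance:
  assumes deg: "degree a \<le> 2" "degree b \<le> 2" and Q: "cond_Q9 a b x z" and "x \<ge> 0" "z \<noteq> 0"
  shows "impedance (network14 (c0 a b x / d0 a b x z)
      ((gamma1 a b x z)^2 / (d0 a b x z * lambda1 a b x z))
      (d2 a b x z * lambda1 a b x z / ((beta a b x)^3 * eta a b x z * F0 a b))
      (alpha a b x / beta a b x) (x / (beta a b x * z)) (beta a b x * z)
      ((beta a b x)^3 * eta a b x z * gamma1 a b x z * F0 a b / (lambda1 a b x z)^2)
      (gamma1 a b x z / (d0 a b x z)^2)) = Some (Fract a b)"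
proof -
  note pos = cond_Q9_imp[OF deg Q \<open>x \<ge> 0\<close>]
  have B: "beta a b x \<noteq> 0" by (rule cond_Q9_beta_nonzero[OF deg Q \<open>x \<ge> 0\<close>])
  have S: "same_sign {alpha a b x, beta a b x, z, d0 a b x z, d1 a b x z, d2 a b x z,
                f0 a b x, f1 a b x, lambda1 a b x z}"
    using Q by (simp add: cond_Q9_def)
  let ?c = "[:c0 a b x, c1 a b x, c2 a b x:]"
    and ?d = "[:d0 a b x z, d1 a b x z, d2 a b x z:]" and ?X = "[:1, x:]"
  define a0 a1 a2 b0 b1 b2 where ab_defs: "a0 = coeff a 0" "a1 = coeff a 1" "a2 = coeff a 2"
    "b0 = coeff b 0" "b1 = coeff b 1" "b2 = coeff b 2"
  have ab: "[:a0, a1, a2:] = a" "[:b0, b1, b2:] = b"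
    by (simp_all only: ab_defs poly_degree_le_2[OF deg(1), symmetric] poly_degree_le_2[OF deg(2), symmetric])
  have "d0 a b x z \<noteq> 0" using pos(2) by auto
  then have "b0 \<noteq> 0" by (auto simp: d0_def ab_defs)
  then have "b \<noteq> 0" by (auto simp: ab_defs)
  have "gamma2 a b x z \<noteq> 0" using pos(4) by simp
  then have c: "?c \<noteq> 0" and d: "?d \<noteq> 0" by (auto simp: gamma2_def)
  have R5: "x / (beta a b x * z) * (beta a b x * z) = x" using B \<open>z \<noteq> 0\<close> by simp
  have "[:0, beta a b x * z:] * ?c + ?d * ?X = ?X * smult (beta a b x) [:b0, b1, b2:]"
    by (simp add: c0_def c1_def c2_def d0_def d1_def d2_def algebra_simps del: One_nat_def flip: ab_defs)
  then have den: "[:0, beta a b x * z:] * ?c + ?d * ?X = ?X * smult (beta a b x) b"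
    unfolding ab .
  have "smult (alpha a b x) [:b0, b1, b2:] + ?c = smult (beta a b x) [:a0, a1, a2:]"
    using f0_eq[OF deg, of x] u_f1_eq[OF deg, of x] u_f0_f1_eq[OF deg, of x]
    by (simp add: c0_def c1_def c2_def algebra_simps del: One_nat_def flip: ab_defs)
  then have num: "smult (alpha a b x) b + ?c = smult (beta a b x) a"
    unfolding ab .
  have "smult (alpha a b x / beta a b x) (?X * smult (beta a b x) b) + ?X * ?c
      = ?X * (smult (alpha a b x) b + ?c)"
    using B by (simp only: mult_smult_right smult_smult distrib_left) simp
  also have "\<dots> = ?X * smult (beta a b x) a" unfolding num ..
  finally have num': "smult (alpha a b x / beta a b x) (?X * smult (beta a b x) b) + ?X * ?c
      = ?X * smult (beta a b x) a" .
  have den0: "?X * smult (beta a b x) b \<noteq> 0" using B \<open>b \<noteq> 0\<close> by (simp only: mult_eq_0_iff) simp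
  have "beta a b x * z \<ge> 0" by (rule same_sign_mult_nonneg[OF S]) auto
  then have C1: "beta a b x * z > 0" using B \<open>z \<noteq> 0\<close> by (metis mult_eq_0_iff order_le_neq_trans)
  have "impedance (network14 (c0 a b x / d0 a b x z)
      ((gamma1 a b x z)^2 / (d0 a b x z * lambda1 a b x z))
      (d2 a b x z * lambda1 a b x z / ((beta a b x)^3 * eta a b x z * F0 a b))
      (alpha a b x / beta a b x) (x / (beta a b x * z)) (beta a b x * z)
      (((beta a b x)^3 * eta a b x z * F0 a b) * gamma1 a b x z / (lambda1 a b x z)^2)
      (gamma1 a b x z / (d0 a b x z)^2))
    = Some (Fract (?X * smult (beta a b x) a) (?X * smult (beta a b x) b))"
    using impedance_network14[OF
        impedance_rl_realization[OF gamma1_def gamma2_def lambda1_def d0_resultant[OF deg]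
          pos(2) d2_lambda1_nonneg[OF Q] pos(1,3)] C1 c d refl,
        of "x / (beta a b x * z)" "alpha a b x / beta a b x"]
    unfolding R5 den num' using den0 by blast
  also have "Fract (?X * smult (beta a b x) a) (?X * smult (beta a b x) b) = Fract a b"
    using den0 \<open>b \<noteq> 0\<close> by (intro Fract_eqI) (auto simp: algebra_simps)
  finally show ?thesis by (simp only: ac_simps)
qed

lemma cond_Q9_network14:
  assumes deg: "degree a \<le> 2" "degree b \<le> 2" and Q: "cond_Q9 a b x z" and "x \<ge> 0" "z \<noteq> 0"
  shows "c0 a b x / d0 a b x z \<ge> 0"
    "(gamma1 a b x z)^2 / (d0 a b x z * lambda1 a b x z) > 0"
    "d2 a b x z * lambda1 a b x z / ((beta a b x)^3 * eta a b x z * F0 a b) \<ge> 0"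
    "alpha a b x / beta a b x \<ge> 0" "x / (beta a b x * z) \<ge> 0" "beta a b x * z > 0"
    "(beta a b x)^3 * eta a b x z * gamma1 a b x z * F0 a b / (lambda1 a b x z)^2 > 0"
    "gamma1 a b x z / (d0 a b x z)^2 > 0"
proof -
  note pos = cond_Q9_imp[OF deg Q \<open>x \<ge> 0\<close>]
  have B: "beta a b x \<noteq> 0" by (rule cond_Q9_beta_nonzero[OF deg Q \<open>x \<ge> 0\<close>])
  have nz: "d0 a b x z \<noteq> 0" "lambda1 a b x z \<noteq> 0" using pos(2) by auto
  have S: "same_sign {alpha a b x, beta a b x, z, d0 a b x z, d1 a b x z, d2 a b x z,
                f0 a b x, f1 a b x, lambda1 a b x z}"
    using Q by (simp add: cond_Q9_def)
  have quot: "y / w \<ge> 0" if "y * w \<ge> 0" for y w :: real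
    using that by (simp add: zero_le_mult_iff zero_le_divide_iff)
  show "c0 a b x / d0 a b x z \<ge> 0" "alpha a b x / beta a b x \<ge> 0"
    unfolding c0_def by (intro quot same_sign_mult_nonneg[OF S]; simp)+
  have "beta a b x * z \<ge> 0" by (rule same_sign_mult_nonneg[OF S]) auto
  then show "beta a b x * z > 0" using B \<open>z \<noteq> 0\<close> by (metis mult_eq_0_iff order_le_neq_trans)
  then show "x / (beta a b x * z) \<ge> 0" using \<open>x \<ge> 0\<close> by simp
  show "(gamma1 a b x z)^2 / (d0 a b x z * lambda1 a b x z) > 0" using pos by simp
  show "d2 a b x z * lambda1 a b x z / ((beta a b x)^3 * eta a b x z * F0 a b) \<ge> 0"
    using pos(1) d2_lambda1_nonneg[OF Q] by (intro divide_nonneg_pos)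
  have "(beta a b x)^3 * eta a b x z * F0 a b * gamma1 a b x z / (lambda1 a b x z)^2 > 0"
    using nz by (intro divide_pos_pos mult_pos_pos[OF pos(1,3)]) simp
  then show "(beta a b x)^3 * eta a b x z * gamma1 a b x z * F0 a b / (lambda1 a b x z)^2 > 0"
    by (simp only: ac_simps)
  show "gamma1 a b x z / (d0 a b x z)^2 > 0" using pos(3) nz by simp
qed

section \<open>The two signs of \<open>F0\<close>\<close>

lemma Z_classI:
  "admissible N \<Longrightarrow> num_capacitors N \<le> m \<Longrightarrow> num_inductors N \<le> n \<Longrightarrow> impedance N = Some Z
    \<Longrightarrow> Z \<in> Z_class m n"
  by (auto simp: Z_class_def is_impedance_of_def)

text \<open>\<open>x * f0 - f1\<close> is the value at \<open>(x, -1)\<close> of the Bezoutian form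
  of \<open>a\<close> and \<open>b\<close>, whose determinant is \<open>F0\<close>. As both are
  positive, the form is positive definite and the Cauer extraction applies to \<open>a/b\<close>
  itself.\<close>

lemma cond_Q9_F0_pos_Z_class:
  assumes deg: "degree a \<le> 2" "degree b \<le> 2" and Q: "cond_Q9 a b x z" and "x \<ge> 0"
    and F0: "F0 a b > 0" and w: "x * f0 a b x - f1 a b x > 0"
  shows "Fract a b \<in> Z_class 0 2"
proof -
  note pos = cond_Q9_imp[OF deg Q \<open>x \<ge> 0\<close>]
  define a0 a1 a2 b0 b1 b2 where ab_defs: "a0 = coeff a 0" "a1 = coeff a 1" "a2 = coeff a 2"
    "b0 = coeff b 0" "b1 = coeff b 1" "b2 = coeff b 2"
  have ab: "[:a0, a1, a2:] = a" "[:b0, b1, b2:] = b"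
    by (simp_all only: ab_defs poly_degree_le_2[OF deg(1), symmetric] poly_degree_le_2[OF deg(2), symmetric])
  have nonneg: "a0 \<ge> 0" "b0 \<ge> 0" "b2 \<ge> 0" using Q by (auto simp: cond_Q9_def ab_defs)
  have "b0 \<noteq> 0" using pos(2) by (auto simp: d0_def ab_defs)
  with nonneg have b0: "b0 > 0" by simp
  define p q r l where pqr: "p = a1 * b0 - a0 * b1" "q = a2 * b0 - a0 * b2" "r = a2 * b1 - a1 * b2"
    and l: "l = b1 * p - b0 * q"
  have P: "p * r - q^2 > 0" using F0 by (simp add: F0_eq pqr del: One_nat_def flip: ab_defs)
  have form: "x * f0 a b x - f1 a b x = x^2 * p - 2 * x * q + r"
    unfolding f0_bezout[OF deg] f1_bezout[OF deg] ab_defs(1-6)[symmetric] pqr[symmetric] by algebra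
  have "p * (x * f0 a b x - f1 a b x) = (x * p - q)^2 + (p * r - q^2)"
    unfolding form by algebra
  moreover have "(x * p - q)^2 \<ge> 0" by simp
  ultimately have "p * (x * f0 a b x - f1 a b x) > 0" using P by linarith
  with w have p: "p > 0" by (simp add: zero_less_mult_iff)
  \<comment> \<open>The identity of \<open>d0_resultant\<close> with \<open>a\<close> and
    \<open>b\<close> in place of \<open>c\<close> and \<open>d\<close>.\<close>
  have id: "b0 * (p * r - q^2) = l * q - p^2 * b2"
    unfolding l pqr by algebra
  moreover have "b0 * (p * r - q^2) > 0" "p^2 * b2 \<ge> 0" using b0 P nonneg by auto
  ultimately have lq: "l * q > 0" by linarith
  \<comment> \<open>\<open>l\<close> and \<open>q\<close> have the same strict sign; were both
    negative, \<open>l = b1 * p - b0 * q\<close> would be a sum of nonnegative terms.\<close>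
  have "q > 0"
  proof (rule ccontr)
    assume "\<not> q > 0"
    then have "b0 * q \<le> 0" "l < 0" using lq b0 by (auto simp: zero_less_mult_iff mult_le_0_iff)
    moreover have "b1 * p \<ge> 0" using p Q by (auto simp: cond_Q9_def ab_defs)
    ultimately show False unfolding l by linarith
  qed
  with lq have l0: "l > 0" by (simp add: zero_less_mult_iff)
  have imp: "impedance (rl_network (a0 / b0) (p^2 / (b0 * l)) (b2 * l / (p * r - q^2))
      ((p * r - q^2) * p / l^2) (p / b0^2)) = Some (Fract a b)"
    using impedance_rl_realization[OF pqr(1,2) l id] b0 l0 nonneg p P unfolding ab by simp
  have adm: "admissible (rl_network (a0 / b0) (p^2 / (b0 * l)) (b2 * l / (p * r - q^2))
      ((p * r - q^2) * p / l^2) (p / b0^2))"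
    using b0 l0 p P nonneg by (simp add: rl_network_def)
  show ?thesis by (rule Z_classI[OF adm _ _ imp]) (simp_all add: rl_network_def)
qed

text \<open>Increase \<open>\<bar>z\<bar>\<close> until \<open>d2\<close> vanishes; since \<open>F0 < 0\<close>, \<open>\<beta> \<eta>\<close> stays negative on the way.\<close>

lemma cond_Q9_F0_neg_cond_F5:
  assumes deg: "degree a \<le> 2" "degree b \<le> 2" and Q: "cond_Q9 a b x z" and "x \<ge> 0" "z \<noteq> 0"
    and F0: "F0 a b < 0" and w: "x * f0 a b x - f1 a b x < 0"
  shows "\<exists>z'. z' \<noteq> 0 \<and> cond_Q9 a b x z' \<and> cond_F5 a b x z'"
proof -
  note pos = cond_Q9_imp[OF deg Q \<open>x \<ge> 0\<close>]
  have B: "beta a b x \<noteq> 0" by (rule cond_Q9_beta_nonzero[OF deg Q \<open>x \<ge> 0\<close>])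
  define \<alpha> \<beta> k0 k1 b0 b1 b2 where defs: "\<alpha> = alpha a b x" "\<beta> = beta a b x"
    "k0 = f0 a b x" "k1 = f1 a b x" "b0 = coeff b 0" "b1 = coeff b 1" "b2 = coeff b 2"
  have S: "same_sign {\<alpha>, \<beta>, z, d0 a b x z, d1 a b x z, d2 a b x z, k0, k1, lambda1 a b x z}"
    using Q by (simp add: cond_Q9_def defs)
  have \<beta>: "\<beta> \<noteq> 0" using B by (simp add: defs)
  have s: "\<beta> * \<alpha> \<ge> 0" "\<beta> * z \<ge> 0" "\<beta> * k0 \<ge> 0" "\<beta> * k1 \<ge> 0" "\<beta> * d2 a b x z \<ge> 0"
      "\<beta> * d0 a b x z \<ge> 0" "z * k1 \<ge> 0"
    by (rule same_sign_mult_nonneg[OF S]; simp)+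
  have d0: "d0 a b x z' = \<beta> * b0" and d1: "d1 a b x z' = \<beta> * (b1 - z' * k0)"
    and d2: "d2 a b x z' = \<beta> * (b2 - z' * k1)" and c0: "c0 a b x = k0" and c1: "c1 a b x = x * k0 + k1"
    and c2: "c2 a b x = x * k1"
    and eta: "eta a b x z' = \<beta> + z' * (x * k0 - k1)" for z'
    by (simp_all add: d0_def d1_def d2_def c0_def c1_def c2_def eta_def beta_def defs algebra_simps)
  have b: "b0 > 0"
  proof -
    have "b0 \<ge> 0" using Q by (simp add: cond_Q9_def defs)
    moreover have "b0 \<noteq> 0" using pos(2) by (auto simp: d0)
    ultimately show ?thesis by simp
  qed
  have xw: "x * k0 - k1 < 0" using w by (simp add: defs)
  \<comment> \<open>If \<open>f1 = 0\<close>, then \<open>gamma2 = - f0 * d2\<close> is nonpositive,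
    against \<open>gamma2 > 0\<close>.\<close>
  have k1: "k1 \<noteq> 0"
  proof
    assume "k1 = 0"
    with pos(4) have "k0 * d2 a b x z < 0" by (simp add: gamma2_def c0 c2)
    moreover have "k0 * d2 a b x z \<ge> 0" by (rule same_sign_mult_nonneg[OF S]) auto
    ultimately show False by simp
  qed
  have bk: "\<beta> * k1 > 0" using s(4) \<beta> k1 by (metis mult_eq_0_iff order_le_neq_trans)
  have zk: "z * k1 > 0" using s(7) \<open>z \<noteq> 0\<close> k1 by (metis mult_eq_0_iff order_le_neq_trans)
  have "\<beta> * d2 a b x z = \<beta>^2 * (b2 - z * k1)" by (simp add: d2 power2_eq_square)
  with s(5) \<beta> have b2: "b2 - z * k1 \<ge> 0" by (simp add: zero_le_mult_iff)
  with zk have b2': "b2 > 0" by simp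
  define z' where "z' = b2 / k1"
  have z'k: "z' * k1 = b2" using k1 by (simp add: z'_def)
  have z'0: "z' \<noteq> 0" using k1 b2' by (simp add: z'_def)
  have d2': "d2 a b x z' = 0" by (simp add: d2 z'k)
  have "(\<beta> * z') * k1^2 = (\<beta> * k1) * b2" by (simp add: z'k[symmetric] power2_eq_square)
  also have "\<dots> > 0" using bk b2' by (rule mult_pos_pos)
  finally have bz': "\<beta> * z' > 0" by (simp add: zero_less_mult_iff)
  \<comment> \<open>As \<open>d2\<close> at \<open>z\<close> is zero or has the sign of
    \<open>beta\<close>, moving to its zero \<open>z'\<close> cannot decrease
    \<open>beta * z\<close>.\<close>
  have "(\<beta> * z' - \<beta> * z) * k1^2 = (\<beta> * k1) * (b2 - z * k1)"
    by (simp add: z'k[symmetric] power2_eq_square algebra_simps)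
  also have "\<dots> \<ge> 0" using bk b2 by simp
  finally have "\<beta> * z' \<ge> \<beta> * z" using k1 by (simp add: zero_le_mult_iff)
  \<comment> \<open>\<open>eta\<close> is affine in \<open>v\<close> with slope
    \<open>x * f0 - f1 < 0\<close>.\<close>
  then have "\<beta> * z' * (x * k0 - k1) \<le> \<beta> * z * (x * k0 - k1)"
    using xw by (intro mult_right_mono_neg) auto
  then have "\<beta> * eta a b x z' \<le> \<beta> * eta a b x z" by (simp add: eta distrib_left mult.assoc)
  moreover have "\<beta> * eta a b x z \<le> 0"
    using Q F0 by (simp add: cond_Q9_def defs zero_le_mult_iff)
  moreover have "\<beta> * eta a b x z \<noteq> 0" using \<beta> Q by (simp add: cond_Q9_def)
  ultimately have e': "\<beta> * eta a b x z' < 0" by linarith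
  then have eF: "\<beta> * eta a b x z' * F0 a b > 0" using F0 by (simp add: mult_neg_neg)
  define P where "P = gamma1 a b x z' * gamma3 a b x z' - (gamma2 a b x z')^2"
  have "P = \<beta>^2 * (\<beta> * eta a b x z' * F0 a b)"
    unfolding P_def resultant_c_d[OF deg] defs by algebra
  with eF \<beta> have P: "P > 0" by simp
  have g2: "gamma2 a b x z' = x * (\<beta> * k1) * b0"
    by (simp add: gamma2_def c2 d0 d2')
  have g2': "gamma2 a b x z' \<ge> 0" using g2 \<open>x \<ge> 0\<close> bk b by simp
  have g13: "gamma1 a b x z' * gamma3 a b x z' > 0"
    using P zero_le_power2[of "gamma2 a b x z'"] unfolding P_def by linarith
  have g3: "gamma3 a b x z' = x * (\<beta> * k1) * (b1 - z' * k0)"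
    by (simp add: gamma3_def c2 d1 d2')
  \<comment> \<open>Otherwise \<open>gamma1 >= 0\<close> and \<open>gamma3 <= 0\<close>, against
    \<open>gamma1 * gamma3 > 0\<close>.\<close>
  have d1': "b1 - z' * k0 \<ge> 0"
  proof (rule ccontr)
    assume neg: "\<not> b1 - z' * k0 \<ge> 0"
    have "gamma1 a b x z' = (x * (\<beta> * k0) + \<beta> * k1) * b0 + \<beta> * k0 * (z' * k0 - b1)"
      by (simp add: gamma1_def c1 c0 d0 d1 algebra_simps)
    also have "\<dots> \<ge> 0"
    proof -
      have "x * (\<beta> * k0) \<ge> 0" using \<open>x \<ge> 0\<close> s(3) by (rule mult_nonneg_nonneg)
      then have "(x * (\<beta> * k0) + \<beta> * k1) * b0 \<ge> 0" using bk b by simp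
      moreover have "\<beta> * k0 * (z' * k0 - b1) \<ge> 0"
        using neg by (intro mult_nonneg_nonneg[OF s(3)]) simp
      ultimately show ?thesis by (rule add_nonneg_nonneg)
    qed
    finally have "gamma1 a b x z' \<ge> 0" .
    moreover have "gamma3 a b x z' \<le> 0"
      unfolding g3 using neg bk \<open>x \<ge> 0\<close> by (intro mult_nonneg_nonpos) auto
    ultimately have "gamma1 a b x z' * gamma3 a b x z' \<le> 0" by (rule mult_nonneg_nonpos)
    with g13 show False by simp
  qed
  have x0: "x > 0" using g13 g3 \<open>x \<ge> 0\<close> by (cases "x = 0") auto
  \<comment> \<open>With \<open>d2 = 0\<close>, \<open>d0_resultant\<close> reduces to
    \<open>d0 * P = lambda1 * gamma2\<close>, which fixes the sign of
    \<open>lambda1\<close>.\<close>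
  have "\<beta> * b0 * P = lambda1 a b x z' * (x * (\<beta> * k1) * b0)"
    using d0_resultant[OF deg, of x z'] unfolding resultant_c_d[OF deg, symmetric] P_def[symmetric]
    by (simp add: d0 d2' g2)
  then have "\<beta> * b0 * (P - lambda1 a b x z' * x * k1) = 0" by (simp add: algebra_simps)
  then have "P = lambda1 a b x z' * x * k1" using \<beta> b by simp
  then have "\<beta> * lambda1 a b x z' * (x * k1^2) = \<beta> * k1 * P" by (simp add: power2_eq_square)
  also have "\<dots> > 0" using bk P by simp
  finally have l': "\<beta> * lambda1 a b x z' > 0"
    by (rule zero_less_mult_pos2) (use x0 k1 in simp)
  have "\<beta> * d1 a b x z' = \<beta>^2 * (b1 - z' * k0)" "\<beta> * d0 a b x z' = \<beta>^2 * b0"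
    by (simp_all add: d1 d0 power2_eq_square)
  then have "\<beta> * d1 a b x z' \<ge> 0" "\<beta> * d0 a b x z' \<ge> 0" using d1' b by simp_all
  with s bz' l' have "same_sign {\<alpha>, \<beta>, z', d0 a b x z', d1 a b x z', d2 a b x z', k0, k1, lambda1 a b x z'}"
    by (intro same_signI[OF \<beta>]) (auto simp: d2')
  with g2' eF e' Q z'0 d2' show ?thesis
    by (intro exI[of _ z']) (auto simp: cond_Q9_def cond_F5_def defs)
qed

text \<open>As \<open>gamma1 > 0\<close> and \<open>gamma1 * gamma3 > gamma2^2\<close>, completing
  the square makes the Bezoutian form of \<open>c\<close> and \<open>d\<close> positive at
  \<open>(f1, - f0)\<close>, which is nonzero because \<open>gamma2 > 0\<close>. This covers
  \<open>f1 = 0\<close> as well.\<close>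

lemma cond_Q9_cases:
  assumes deg: "degree a \<le> 2" "degree b \<le> 2" and Q: "cond_Q9 a b x z" and "x \<ge> 0" "z \<noteq> 0"
  shows "Fract a b \<in> Z_class 0 2 \<or> (\<exists>z'. z' \<noteq> 0 \<and> cond_Q9 a b x z' \<and> cond_F5 a b x z')"
proof -
  note pos = cond_Q9_imp[OF deg Q \<open>x \<ge> 0\<close>]
  let ?k0 = "f0 a b x" and ?k1 = "f1 a b x"
  let ?g1 = "gamma1 a b x z" and ?g2 = "gamma2 a b x z" and ?g3 = "gamma3 a b x z"
  have k: "?k0 \<noteq> 0 \<or> ?k1 \<noteq> 0" using pos(4) by (auto simp: gamma2_def c0_def c2_def)
  have "?g1 * (?k1^2 * ?g1 - 2 * ?k0 * ?k1 * ?g2 + ?k0^2 * ?g3)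
      = (?k1 * ?g1 - ?k0 * ?g2)^2 + ?k0^2 * (?g1 * ?g3 - ?g2^2)" by algebra
  also have "\<dots> > 0"
  proof (cases "?k0 = 0")
    case True
    with k pos(3) show ?thesis by simp
  next
    case False
    then show ?thesis using pos(1) unfolding resultant_c_d[OF deg]
      by (intro add_nonneg_pos) auto
  qed
  finally have "(beta a b x)^2 * F0 a b * (x * ?k0 - ?k1) > 0"
    unfolding gamma_form_at_zero[OF deg] using pos(3) by (simp add: zero_less_mult_iff)
  then have "F0 a b * (x * ?k0 - ?k1) > 0"
    using cond_Q9_beta_nonzero[OF deg Q \<open>x \<ge> 0\<close>]
    by (simp only: mult.assoc) (erule zero_less_mult_pos, simp)
  then consider "F0 a b > 0" "x * ?k0 - ?k1 > 0" | "F0 a b < 0" "x * ?k0 - ?k1 < 0"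
    by (auto simp: zero_less_mult_iff)
  then show ?thesis
    using cond_Q9_F0_pos_Z_class[OF deg Q \<open>x \<ge> 0\<close>]
      cond_Q9_F0_neg_cond_F5[OF deg Q \<open>x \<ge> 0\<close> \<open>z \<noteq> 0\<close>] by cases blast+
qed

section \<open>Networks with biquadratic impedance\<close>

text \<open>A priori the network has a cubic numerator and denominator, so they share a factor \<open>g\<close>;
  since the impedance of the inner RL network is in lowest terms, \<open>g\<close> must be proportional
  to \<open>R5 C1 s + 1\<close> and divide \<open>c\<close>.\<close>

lemma network14_cond_Q9:
  fixes a b :: "real poly"
  assumes deg: "degree a \<le> 2" "degree b \<le> 2" and cop: "coprime a b"
    and ab2: "coeff a 2 \<noteq> 0 \<or> coeff b 2 \<noteq> 0" and bpos: "\<exists>i\<in>{0,1,2}. coeff b i > 0"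
    and par: "R1 \<ge> 0" "R4 \<ge> 0" "R5 \<ge> 0" "R2 > 0" "G3 \<ge> 0" "C1 > 0" "L1 > 0" "L2 > 0"
    and imp: "impedance (network14 R1 R2 G3 R4 R5 C1 L1 L2) = Some (Fract a b)"
  shows "\<exists>x z. x \<ge> 0 \<and> z \<noteq> 0 \<and> cond_Q9 a b x z"
proof -
  \<comment> \<open>\<open>R2\<close> in series with the parallel \<open>G3\<close>,
    \<open>L1\<close> has impedance \<open>(R2 + A s) / (1 + G3 L1 s)\<close>; the \<open>K\<close>s
    and \<open>D\<close>s are coefficients of \<open>c\<close> and \<open>d\<close>.\<close>
  define A D1 D2 K0 K1 K2 x where "A = (1 + R2 * G3) * L1" and D1: "D1 = A + L2"
    and D2: "D2 = G3 * L1 * L2" and K0: "K0 = R1 * R2" and K1: "K1 = R1 * D1 + L2 * R2"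
    and K2: "K2 = R1 * D2 + L2 * A" and x: "x = R5 * C1"
  have A: "A = L1 + R2 * G3 * L1" by (simp add: A_def algebra_simps)
  have A0: "A > 0" unfolding A using par by (simp add: add_pos_nonneg)
  have D: "D1 > 0" "D2 \<ge> 0" unfolding D1 D2 using par A0 by simp_all
  then have "R1 * D1 \<ge> 0" "R1 * D2 \<ge> 0" "L2 * R2 > 0" "L2 * A > 0" using par A0 by simp_all
  then have "R1 * D1 + L2 * R2 > 0" "R1 * D2 + L2 * A > 0" by linarith+
  then have sgn: "D1 > 0" "D2 \<ge> 0" "K0 \<ge> 0" "K1 > 0" "K2 > 0" "x \<ge> 0"
    unfolding K1 K2 K0 x using par D by simp_all
  let ?c = "[:K0, K1, K2:]" and ?d = "[:R2, D1, D2:]" and ?X = "[:1, x:]"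
  have rl: "impedance (rl_network R1 R2 G3 L1 L2) = Some (Fract ?c ?d)"
    using impedance_rl_network[of R2 G3 L1 L2 R1] par by (simp add: K0 K1 K2 D1 D2 A_def)
  define Q where "Q = [:0, C1:] * ?c + ?d * ?X"
  have Q: "Q = [:R2, C1 * K0 + D1 + x * R2, C1 * K1 + D2 + x * D1, C1 * K2 + x * D2:]"
    by (simp add: Q_def algebra_simps)
  have lead: "C1 * K2 + x * D2 > 0" using par sgn by (simp add: add_pos_nonneg)
  then have degQ: "degree Q = 3" by (simp add: Q)
  then have "Q \<noteq> 0" by auto
  have "b \<noteq> 0" using bpos by auto
  define h where "h = a - smult R4 b"
  have "Fract (smult R4 Q + ?X * ?c) Q = Fract a b"
    using impedance_network14[OF rl \<open>C1 > 0\<close> _ _ Q_def[unfolded x] \<open>Q \<noteq> 0\<close>, of R4] imp sgn par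
    by (simp add: x)
  then have "(smult R4 Q + ?X * ?c) * b = a * Q"
    using eq_fract(1)[OF \<open>Q \<noteq> 0\<close> \<open>b \<noteq> 0\<close>] by blast
  then have eq: "(?X * ?c) * b = h * Q"
    unfolding h_def by (simp only: left_diff_distrib distrib_right mult_smult_left mult.commute[of Q b])
  have "b dvd a * Q" using \<open>(smult R4 Q + ?X * ?c) * b = a * Q\<close> by (metis dvd_triv_right)
  then have "b dvd Q" using cop by (metis coprime_dvd_mult_right_iff coprime_commute)
  then obtain g where g: "Q = b * g" ..
  with \<open>Q \<noteq> 0\<close> have "g \<noteq> 0" by auto
  have hg: "?X * ?c = h * g"
    using eq \<open>b \<noteq> 0\<close> unfolding g by (metis mult.assoc mult.commute mult_right_cancel)
  have degbg: "degree b + degree g = 3" using degQ \<open>b \<noteq> 0\<close> \<open>g \<noteq> 0\<close> by (simp add: g degree_mult_eq)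
  \<comment> \<open>If \<open>b\<close> had smaller degree, \<open>h\<close> would have degree at
    least 2 and so would \<open>g\<close>, so \<open>h * g\<close> would exceed the degree of
    \<open>(x s + 1) c\<close>.\<close>
  have "degree b = 2"
  proof (rule ccontr)
    assume "degree b \<noteq> 2"
    with deg have b1: "degree b < 2" by simp
    then have "coeff b 2 = 0" by (simp add: coeff_eq_0)
    with ab2 have "coeff h 2 \<noteq> 0" by (simp add: h_def)
    then have "degree h \<ge> 2" "h \<noteq> 0" by (auto simp: le_degree)
    then have "degree (h * g) \<ge> 4" using b1 degbg \<open>g \<noteq> 0\<close> by (simp add: degree_mult_eq)
    moreover have "degree (?X * ?c) \<le> 3"
      using degree_mult_le[of ?X ?c] by (simp split: if_splits)
    ultimately show False unfolding hg by simp
  qed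
  with degbg have "degree g = 1" by simp
  define g0 g1 where g01: "g0 = coeff g 0" "g1 = coeff g 1"
  have gp: "g = [:g0, g1:]" and "g1 \<noteq> 0"
    using \<open>degree g = 1\<close> unfolding g01
    by (auto intro!: poly_eqI simp: coeff_pCons coeff_eq_0 split: nat.split)
       (metis One_nat_def leading_coeff_neq_0 \<open>g \<noteq> 0\<close>)
  define s where "s = - g0 / g1"
  have gs: "poly g s = 0" using \<open>g1 \<noteq> 0\<close> by (simp add: gp s_def)
  have Xc: "(1 + x * s) * poly ?c s = 0"
    using arg_cong[OF hg, of "\<lambda>p. poly p s"] gs by (simp only: poly_mult) (simp add: algebra_simps)
  have Qs: "C1 * s * poly ?c s + poly ?d s * (1 + x * s) = 0"
    using arg_cong[OF g, of "\<lambda>p. poly p s"] gs unfolding Q_def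
    by (simp only: poly_mult poly_add) (simp add: algebra_simps)
  \<comment> \<open>Otherwise \<open>c\<close> and \<open>d\<close> vanish at \<open>s\<close>,
    hence so does \<open>s (R2 + A s)\<close>. But \<open>d\<close> is \<open>R2\<close> at 0, and
    in the other case \<open>R2 + A s\<close> and \<open>1 + G3 L1 s\<close> vanish together,
    forcing \<open>L1 = 0\<close>.\<close>
  have xs: "1 + x * s = 0"
  proof (rule ccontr)
    assume "1 + x * s \<noteq> 0"
    with Xc Qs have c: "poly ?c s = 0" and d: "poly ?d s = 0" by auto
    have "poly ?c s = R1 * poly ?d s + L2 * s * (R2 + A * s)"
      by (simp add: K0 K1 K2 algebra_simps)
    with c d par have "s = 0 \<or> R2 + A * s = 0" by simp
    then show False
    proof
      assume "s = 0"
      with d par show False by simp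
    next
      assume *: "R2 + A * s = 0"
      then have "s \<noteq> 0" using par by auto
      have "poly ?d s = (R2 + A * s) + L2 * s * (1 + G3 * L1 * s)"
        by (simp add: D1 D2 algebra_simps)
      with d * \<open>s \<noteq> 0\<close> par have "1 + G3 * L1 * s = 0" by simp
      moreover have "L1 = A * (1 + G3 * L1 * s) - G3 * L1 * (R2 + A * s)"
        by (simp add: A algebra_simps)
      ultimately have "L1 = 0" using * by simp
      with par show False by simp
    qed
  qed
  then have "x \<noteq> 0" by auto
  with sgn have x0: "x > 0" by simp
  have s: "s = - 1 / x" using xs x0 by (simp add: field_simps)
  then have "s \<noteq> 0" using x0 by simp
  with Qs xs par have "poly ?c s = 0" by simp
  then have "K0 * x^2 - K1 * x + K2 = 0"
    using x0 by (simp add: s field_simps power2_eq_square)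
  then have K1': "K1 = x * K0 + K2 / x" using x0 by (simp add: field_simps power2_eq_square)
  \<comment> \<open>Now \<open>c = (x s + 1) (e s + K0)\<close>.\<close>
  define e where "e = K2 / x"
  have K2': "K2 = x * e" and K1'': "K1 = x * K0 + e" using x0 K1' by (simp_all add: e_def)
  have e0: "e > 0" using x0 sgn by (simp add: e_def)
  have g1: "g1 = x * g0" using gs \<open>g1 \<noteq> 0\<close> x0 by (simp add: gp s field_simps)
  with \<open>g1 \<noteq> 0\<close> have "g0 \<noteq> 0" by auto
  define a0 a1 a2 b0 b1 b2 where ab_defs: "a0 = coeff a 0" "a1 = coeff a 1" "a2 = coeff a 2"
    "b0 = coeff b 0" "b1 = coeff b 1" "b2 = coeff b 2"
  have ab: "a = [:a0, a1, a2:]" "b = [:b0, b1, b2:]"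
    unfolding ab_defs by (intro poly_degree_le_2 deg)+
  \<comment> \<open>Cancelling \<open>x s + 1\<close> gives
    \<open>g0 b = d + C1 s (e s + K0)\<close>, and further below
    \<open>g0 (a - R4 b) = c\<close>.\<close>
  have "[:R2, C1 * K0 + D1 + x * R2, C1 * K1 + D2 + x * D1, C1 * K2 + x * D2:]
      = [:b0, b1, b2:] * [:g0, x * g0:]"
    using g unfolding Q gp g1 ab .
  then have E: "g0 * b0 = R2" "C1 * K0 + D1 + x * R2 = g0 * b1 + x * (g0 * b0)"
    "x * (g0 * b2) = C1 * K2 + x * D2"
    by (auto simp: algebra_simps)
  have "x * (g0 * b2) = x * (C1 * e + D2)"
    unfolding E(3) K2' by (simp add: algebra_simps)
  then have "g0 * b2 = C1 * e + D2" using x0 by simp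
  with E(1,2) have gb: "g0 * b0 = R2" "g0 * b1 = C1 * K0 + D1" "g0 * b2 = C1 * e + D2"
    by simp_all
  define h0 h1 h2 where h_defs: "h0 = a0 - R4 * b0" "h1 = a1 - R4 * b1" "h2 = a2 - R4 * b2"
  have h: "h = [:h0, h1, h2:]" unfolding h_def ab h_defs by simp
  have "[:1, x:] * [:K0, K1, K2:] = [:K0, K1 + x * K0, K2 + x * K1, x * K2:]"
    "[:h0, h1, h2:] * [:g0, x * g0:]
      = [:g0 * h0, g0 * h1 + x * (g0 * h0), g0 * h2 + x * (g0 * h1), x * (g0 * h2):]"
    by (simp_all add: algebra_simps)
  then have "[:K0, K1 + x * K0, K2 + x * K1, x * K2:]
      = [:g0 * h0, g0 * h1 + x * (g0 * h0), g0 * h2 + x * (g0 * h1), x * (g0 * h2):]"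
    using hg unfolding h gp g1 by metis
  then have "g0 * h0 = K0" "K1 + x * K0 = g0 * h1 + x * (g0 * h0)" "x * (g0 * h2) = x * K2"
    by auto
  then have ga: "g0 * (a0 - R4 * b0) = K0" "g0 * (a1 - R4 * b1) = K1" "g0 * (a2 - R4 * b2) = K2"
    using x0 by (simp_all flip: h_defs)
  have gb0: "g0 * b0 \<ge> 0" "g0 * b1 \<ge> 0" "g0 * b2 \<ge> 0"
    unfolding gb using par sgn e0 by simp_all
  \<comment> \<open>A positive coefficient of \<open>b\<close> excludes
    \<open>g0 < 0\<close>.\<close>
  have "b0 > 0 \<or> b1 > 0 \<or> b2 > 0" using bpos by (simp add: ab_defs)
  with gb0 \<open>g0 \<noteq> 0\<close> have g0: "g0 > 0" by (auto simp: zero_le_mult_iff)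
  have b_nonneg: "b0 \<ge> 0" "b1 \<ge> 0" "b2 \<ge> 0" using gb0 g0 by (simp_all add: zero_le_mult_iff)
  have "g0 * (a0 - R4 * b0) \<ge> 0" "g0 * (a1 - R4 * b1) \<ge> 0" "g0 * (a2 - R4 * b2) \<ge> 0"
    unfolding ga using sgn by simp_all
  then have "a0 - R4 * b0 \<ge> 0" "a1 - R4 * b1 \<ge> 0" "a2 - R4 * b2 \<ge> 0"
    using g0 by (simp_all add: zero_le_mult_iff)
  moreover have "R4 * b0 \<ge> 0" "R4 * b1 \<ge> 0" "R4 * b2 \<ge> 0" using par b_nonneg by simp_all
  ultimately have a_nonneg: "a0 \<ge> 0" "a1 \<ge> 0" "a2 \<ge> 0" by linarith+

  define \<beta> where "\<beta> = beta a b x"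
  have \<beta>: "\<beta> = b0 * x^2 - b1 * x + b2" by (simp only: \<beta>_def beta_def ab_defs)
  \<comment> \<open>\<open>a - R4 b\<close> is proportional to \<open>c\<close>, so it vanishes at
    \<open>-1/x\<close>.\<close>
  have "g0 * (alpha a b x - R4 * \<beta>)
      = g0 * (a0 - R4 * b0) * x^2 - g0 * (a1 - R4 * b1) * x + g0 * (a2 - R4 * b2)"
    unfolding \<beta> alpha_def ab_defs by algebra
  also have "\<dots> = 0" unfolding ga using \<open>K0 * x^2 - K1 * x + K2 = 0\<close> .
  finally have \<alpha>: "alpha a b x = R4 * \<beta>" using g0 by simp
  have \<beta>0: "\<beta> \<noteq> 0"
  proof
    assume "\<beta> = 0"
    moreover have "poly b s * x^2 = \<beta>" "poly a s * x^2 = alpha a b x"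
      using x0 unfolding \<beta> alpha_def ab_defs(1-3)[symmetric]
      by (simp_all add: ab s field_simps power2_eq_square)
    ultimately have "poly a s = 0" "poly b s = 0" using \<alpha> x0 by auto
    then show False using coprime_poly_0[OF cop] by blast
  qed
  \<comment> \<open>Scale factor: \<open>c\<close> and \<open>d\<close> formed from
    \<open>a\<close>, \<open>b\<close> and \<open>z = C1 / beta\<close> are \<open>t\<close> times
    those of the network, and \<open>t\<close> has the sign of \<open>beta\<close>.\<close>
  define t where "t = \<beta> / g0"
  have t0: "t \<noteq> 0" using \<beta>0 g0 by (simp add: t_def)
  have f0: "f0 a b x = t * K0"
  proof -
    have "f0 a b x = \<beta> * (a0 - R4 * b0)"
      unfolding f0_eq[OF deg] \<alpha> \<beta>_def[symmetric] ab_defs by (simp add: algebra_simps)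
    then show ?thesis using g0 by (simp add: t_def flip: ga(1))
  qed
  have f1: "f1 a b x = t * e"
  proof -
    have "x * f1 a b x = \<beta> * (a2 - R4 * b2)"
      unfolding u_f1_eq[OF deg] \<alpha> \<beta>_def[symmetric] ab_defs by (simp add: algebra_simps)
    also have "\<dots> = t * K2" using g0 by (simp add: t_def flip: ga(3))
    also have "\<dots> = x * (t * e)" by (simp add: K2')
    finally show ?thesis using x0 by simp
  qed
  define z where "z = C1 / \<beta>"
  have z: "z \<noteq> 0" "\<beta> * z = C1" using \<beta>0 par by (simp_all add: z_def)
  have zt: "z * t = C1 / g0" using \<beta>0 by (simp add: z_def t_def)
  have b: "b0 = R2 / g0" "b1 = (C1 * K0 + D1) / g0" "b2 = (C1 * e + D2) / g0"
    using g0 gb by (simp_all add: field_simps)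
  have c: "c0 a b x = t * K0" "c1 a b x = t * K1" "c2 a b x = t * K2"
    by (simp_all add: c0_def c1_def c2_def f0 f1 K1'' K2' algebra_simps)
  have d: "d0 a b x z = t * R2" "d1 a b x z = t * D1" "d2 a b x z = t * D2"
  proof -
    have "d0 a b x z = \<beta> * b0" "d1 a b x z = \<beta> * (b1 - (z * t) * K0)"
      "d2 a b x z = \<beta> * (b2 - (z * t) * e)"
      by (simp_all only: d0_def d1_def d2_def f0 f1 \<beta>_def ab_defs mult.assoc)
    then show "d0 a b x z = t * R2" "d1 a b x z = t * D1" "d2 a b x z = t * D2"
      unfolding zt b by (simp_all add: t_def diff_divide_distrib[symmetric])
  qed
  have \<gamma>1: "gamma1 a b x z = t^2 * (L2 * R2^2)"
    unfolding gamma1_def c d K1 K0 by algebra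
  have \<gamma>2: "gamma2 a b x z = t^2 * (L2 * A * R2)"
    unfolding gamma2_def c d K2 K0 by algebra
  have l1: "lambda1 a b x z = t^3 * (L2^2 * R2^2)"
    unfolding lambda1_def \<gamma>1 \<gamma>2 d D1 by algebra
  define P where "P = \<beta>^3 * eta a b x z * F0 a b"
  have "t * R2 * P = t^5 * (L2^3 * R2^3 * L1)"
    using d0_resultant[OF deg, of x z]
    unfolding l1 \<gamma>1 \<gamma>2 d D2 A P_def \<beta>_def by algebra
  \<comment> \<open>Cancelling \<open>t * R2\<close> leaves an even power of \<open>t\<close>, so
    \<open>P > 0\<close> for either sign of \<open>beta\<close>.\<close>
  then have "(t * R2) * P = (t * R2) * (t^4 * (L2^3 * R2^2 * L1))" by algebra
  then have "P = t^4 * (L2^3 * R2^2 * L1)" using t0 par by simp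
  then have "P > 0" using t0 par by simp
  moreover have "P = \<beta>^2 * (\<beta> * eta a b x z * F0 a b)" unfolding P_def by algebra
  ultimately have pos: "\<beta> * eta a b x z * F0 a b > 0" using \<beta>0
    by (simp only: zero_less_mult_iff[of "\<beta>^2"]) auto
  have bt: "\<beta> * (t * y) \<ge> 0" if "y \<ge> 0" for y
  proof -
    have "\<beta> * (t * y) = \<beta>^2 * y / g0" by (simp add: t_def power2_eq_square)
    then show ?thesis using that g0 by simp
  qed
  have "same_sign {alpha a b x, \<beta>, z, d0 a b x z, d1 a b x z, d2 a b x z,
                f0 a b x, f1 a b x, lambda1 a b x z}"
  proof (rule same_signI[OF \<beta>0])
    have l1': "lambda1 a b x z = t * (t^2 * (L2^2 * R2^2))" unfolding l1 by algebra
    have "\<beta> * lambda1 a b x z \<ge> 0" unfolding l1' by (rule bt) simp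
    moreover have "\<beta> * alpha a b x = R4 * \<beta>^2" by (simp add: \<alpha> power2_eq_square)
    then have "\<beta> * alpha a b x \<ge> 0" using par by simp
    ultimately show "0 \<le> \<beta> * y" if "y \<in> {alpha a b x, \<beta>, z, d0 a b x z, d1 a b x z, d2 a b x z,
                f0 a b x, f1 a b x, lambda1 a b x z}" for y
      using that z par sgn e0 by (auto simp: d f0 f1 bt)
  qed
  moreover have "gamma2 a b x z \<ge> 0" unfolding \<gamma>2 using par A0 by simp
  moreover have "\<forall>i\<in>{0,1,2}. coeff a i \<ge> 0 \<and> coeff b i \<ge> 0"
    using a_nonneg b_nonneg by (simp add: ab_defs)
  ultimately have "cond_Q9 a b x z"
    using pos unfolding cond_Q9_def \<beta>_def by auto
  then show ?thesis using x0 z by (intro exI[of _ x] exI[of _ z]) simp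
qed

theorem theorem27:
  fixes a b :: "real poly" and Z :: "real poly fract"
  assumes "degree a \<le> 2" and "degree b \<le> 2"
    and "coprime a b"
    and "coeff a 2 \<noteq> 0 \<or> coeff b 2 \<noteq> 0"
    and "\<exists>i\<in>{0,1,2}. coeff b i > 0"
    and "Z = Fract a b"
  shows
    "((\<exists>N\<in>class_N14. is_impedance_of Z N) \<longrightarrow>
        Z \<in> Z_class 1 1 \<or> Z \<in> Z_class 0 2 \<or>
        (\<exists>x z. x \<ge> 0 \<and> z \<noteq> 0 \<and> cond_Q9 a b x z \<and> cond_F5 a b x z))
     \<and>
     (\<forall>x z. x \<ge> 0 \<and> z \<noteq> 0 \<and> cond_Q9 a b x z \<longrightarrow>
        beta a b x \<noteq> 0 \<and> d0 a b x z \<noteq> 0 \<and> lambda1 a b x z \<noteq> 0 \<and> gamma1 a b x z > 0 \<and>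
        (let R1 = c0 a b x / d0 a b x z;
             R2 = (gamma1 a b x z)^2 / (d0 a b x z * lambda1 a b x z);
             G3 = d2 a b x z * lambda1 a b x z / ((beta a b x)^3 * eta a b x z * F0 a b);
             R4 = alpha a b x / beta a b x;
             R5 = x / (beta a b x * z);
             C1 = beta a b x * z;
             L1 = (beta a b x)^3 * eta a b x z * gamma1 a b x z * F0 a b / (lambda1 a b x z)^2;
             L2 = gamma1 a b x z / (d0 a b x z)^2;
             N = network14 R1 R2 G3 R4 R5 C1 L1 L2
         in N \<in> class_N14 \<and> is_impedance_of Z N \<and>
            (cond_F5 a b x z \<longrightarrow> G3 = 0 \<and> N \<in> class_N29)))"
proof (intro conjI impI allI)
  assume "\<exists>N\<in>class_N14. is_impedance_of Z N"
  then obtain N where N: "N \<in> class_N14" and imp: "impedance N = Some (Fract a b)"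
    unfolding is_impedance_of_def assms(6) by auto
  from N obtain R1 R2 G3 R4 R5 C1 L1 L2 where N_eq: "N = network14 R1 R2 G3 R4 R5 C1 L1 L2"
    and par: "R1 \<ge> 0" "R4 \<ge> 0" "R5 \<ge> 0" "R2 > 0" "G3 \<ge> 0" "C1 > 0" "L1 > 0" "L2 > 0"
    unfolding class_N14_def by blast
  from network14_cond_Q9[OF assms(1-5) par imp[unfolded N_eq]]
  obtain x z where "x \<ge> 0" "z \<noteq> 0" "cond_Q9 a b x z"
    by blast
  \<comment> \<open>\<open>cond_Q9_cases\<close> keeps \<open>x\<close> and changes only
    \<open>z\<close>.\<close>
  then show "Z \<in> Z_class 1 1 \<or> Z \<in> Z_class 0 2 \<or>
      (\<exists>x z. x \<ge> 0 \<and> z \<noteq> 0 \<and> cond_Q9 a b x z \<and> cond_F5 a b x z)"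
    using cond_Q9_cases[OF assms(1,2)] unfolding assms(6) by blast
next
  fix x z
  assume "x \<ge> 0 \<and> z \<noteq> 0 \<and> cond_Q9 a b x z"
  then have x: "x \<ge> 0" and z: "z \<noteq> 0" and Q: "cond_Q9 a b x z" by simp_all
  note pos = cond_Q9_imp[OF assms(1,2) Q x]
  show "beta a b x \<noteq> 0" by (rule cond_Q9_beta_nonzero[OF assms(1,2) Q x])
  show "d0 a b x z \<noteq> 0" "lambda1 a b x z \<noteq> 0" using pos(2) by auto
  show "gamma1 a b x z > 0" by (rule pos(3))
  have F5: "d2 a b x z * lambda1 a b x z / ((beta a b x)^3 * eta a b x z * F0 a b) = 0"
    if "cond_F5 a b x z"
    using that by (simp add: cond_F5_def)
  note par = cond_Q9_network14[OF assms(1,2) Q x z]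
  show "let R1 = c0 a b x / d0 a b x z;
             R2 = (gamma1 a b x z)^2 / (d0 a b x z * lambda1 a b x z);
             G3 = d2 a b x z * lambda1 a b x z / ((beta a b x)^3 * eta a b x z * F0 a b);
             R4 = alpha a b x / beta a b x;
             R5 = x / (beta a b x * z);
             C1 = beta a b x * z;
             L1 = (beta a b x)^3 * eta a b x z * gamma1 a b x z * F0 a b / (lambda1 a b x z)^2;
             L2 = gamma1 a b x z / (d0 a b x z)^2;
             N = network14 R1 R2 G3 R4 R5 C1 L1 L2
         in N \<in> class_N14 \<and> is_impedance_of Z N \<and>
            (cond_F5 a b x z \<longrightarrow> G3 = 0 \<and> N \<in> class_N29)"
    unfolding Let_def is_impedance_of_def assms(6)
  proof (intro conjI impI cond_Q9_impedance[OF assms(1,2) Q x z])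
    show "network14 (c0 a b x / d0 a b x z)
      ((gamma1 a b x z)^2 / (d0 a b x z * lambda1 a b x z))
      (d2 a b x z * lambda1 a b x z / ((beta a b x)^3 * eta a b x z * F0 a b))
      (alpha a b x / beta a b x) (x / (beta a b x * z)) (beta a b x * z)
      ((beta a b x)^3 * eta a b x z * gamma1 a b x z * F0 a b / (lambda1 a b x z)^2)
      (gamma1 a b x z / (d0 a b x z)^2) \<in> class_N14"
      using par unfolding class_N14_def by blast
    show "network14 (c0 a b x / d0 a b x z)
      ((gamma1 a b x z)^2 / (d0 a b x z * lambda1 a b x z))
      (d2 a b x z * lambda1 a b x z / ((beta a b x)^3 * eta a b x z * F0 a b))
      (alpha a b x / beta a b x) (x / (beta a b x * z)) (beta a b x * z)
      ((beta a b x)^3 * eta a b x z * gamma1 a b x z * F0 a b / (lambda1 a b x z)^2)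
      (gamma1 a b x z / (d0 a b x z)^2) \<in> class_N29" if "cond_F5 a b x z"
      using par unfolding class_N29_def F5[OF that] by blast
  qed (rule F5)
qed

end
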